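(* Let $q\in\mathbb{C}$ with $0<|q|<1$. For generic $z\in\mathbb{C}^*$, $$-qz^{-3}\frac{\Theta(-q^{2}z^{3};q^4)\Theta(z^{12};q^{16})}{\Theta(z;q^4)}+z^{5}\frac{\Theta(-qz^{3};q^4)\Theta(q^{12}z^{12};q^{16})}{\Theta(qz;q^4)}+z\frac{\Theta(-z^{3};q^4)\Theta(q^{8}z^{12};q^{16})}{\Theta(q^2z;q^4)}+\frac{\Theta(-q^{3}z^{3};q^4)\Theta(q^{4}z^{12};q^{16})}{\Theta(q^3z;q^4)}$$ $$=\frac{(q;q)_{\infty}(q^{16};q^{16})_{\infty}\,\Theta(-z^{4};q^2)\,\Theta(qz^2;q^2)\,\Theta(-z;q)}{(q^{8};q^{8})_{\infty}(q^2;q^2)_{\infty}^3}.$$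
   Context: $\mathbb{C}^*=\mathbb{C}\setminus\{0\}$. For $Q\in\mathbb{C}$ with $0<|Q|<1$ and $x\in\mathbb{C}$, $(x;Q)_\infty=\prod_{i\ge 0}(1-Q^i x)$. For $x\in\mathbb{C}^*$, $$\Theta(x;Q)=(x;Q)_\infty(Q/x;Q)_\infty(Q;Q)_\infty=\sum_{n=-\infty}^{\infty}(-1)^nQ^{\binom n2}x^n .$$ "Generic" means that no denominator in the identity vanishes. *)

theory Defs
  imports "HOL-Analysis.Analysis"
begin

text \<open>
  Both functions are meaningful only for nonzero \<open>Q\<close> of norm less than 1, and
  \<open>qTheta x Q\<close> only for nonzero \<open>x\<close>. The product is \<^const>\<open>prodinf\<close>,
  which is 0 when some factor vanishes.
\<close>

definition qpoch_inf :: "complex \<Rightarrow> complex \<Rightarrow> complex" where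
  "qpoch_inf x Q = (\<Prod>i. 1 - Q ^ i * x)"

definition qTheta :: "complex \<Rightarrow> complex \<Rightarrow> complex" where
  "qTheta x Q = qpoch_inf x Q * qpoch_inf (Q / x) Q * qpoch_inf Q Q"

end

theory Submission
  imports Defs "HOL-Complex_Analysis.Complex_Analysis"
begin

text \<open>
  Call a function \<open>f\<close>, holomorphic on the punctured plane, a theta function with multiplier \<open>\<mu>\<close>
  if \<open>f (q z) = \<mu>(z) f(z)\<close>, where \<open>\<mu>\<close> has no zeros. If \<open>P\<close> has the same multiplier and only simple
  zeros, and \<open>f\<close> vanishes wherever \<open>P\<close> does, then \<open>f / P\<close> extends holomorphically and is invariant
  under \<open>z \<mapsto> q z\<close>. Its pullback along \<^const>\<open>exp\<close> is entire and bounded, because every orbit meets a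
  compact annulus; by Liouville it is constant. This is \<open>quasi_periodic_proportional\<close>, and it reduces
  the identity to the multipliers of both sides, the zeros of the right-hand side, and one value.

  The four summands on the left form one orbit of \<open>z \<mapsto> q z\<close>: each is carried to the next, up to
  the common factor \<open>- 1 / (q\<^sup>3 z\<^sup>1\<^sup>1)\<close> (\<open>theta_sum_shift\<close>). Multiplication with the four
  denominators removes all poles. After this multiplication the right-hand side becomes a constant
  times \<open>\<Theta>(-z\<^sup>4; q\<^sup>2) \<Theta>(z\<^sup>2; q)\<close>, whose zeros are simple and, modulo powers of \<open>q\<close>, are the points
  with \<open>z\<^sup>2 = 1\<close>, \<open>z\<^sup>2 = q\<close>, \<open>z\<^sup>4 = -1\<close> or \<open>z\<^sup>4 = -q\<^sup>2\<close>.

  The left-hand side vanishes there for four different reasons. At \<open>z = 1\<close> the product of the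
  denominators is zero. At \<open>z = -1\<close> the symmetry \<open>z \<mapsto> 1 / z\<close>
  (\<open>theta_sum_inverse\<close>) shows that the sum is its own negative, and so does this symmetry combined
  with the shift at \<open>z\<^sup>2 = q\<close>. If \<open>z\<^sup>4 = -q\<^sup>2\<close>, every denominator cancels
  against a numerator and the summands cancel in pairs. The case \<open>z\<^sup>4 = -1\<close> is the substantial one:
  it amounts to a relation between \<open>\<Theta>(q\<^sup>k z; q\<^sup>4)\<close>, \<open>k = 0, 1, 2, 3\<close>
  (\<open>theta_relation_fourth_root_minus_one\<close>), which follows from the duplication formulas and from
  \<open>qTheta_square_difference\<close>, itself another instance of \<open>quasi_periodic_proportional\<close>.

  The constant is read off at \<open>z = \<i>\<close>, where the first summand vanishes and the
  others are multiples of the same infinite product.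
\<close>

section \<open>The infinite q-shifted factorial\<close>

lemma convergent_prod_qpoch:
  fixes x Q :: complex
  assumes "norm Q < 1"
  shows "convergent_prod (\<lambda>i. 1 - Q ^ i * x)"
proof (rule abs_convergent_prod_imp_convergent_prod)
  have "summable (\<lambda>i. norm Q ^ i * norm x)"
    using assms by (intro summable_mult2 summable_geometric) auto
  then show "abs_convergent_prod (\<lambda>i. 1 - Q ^ i * x)"
    by (simp add: abs_convergent_prod_conv_summable norm_mult norm_power)
qed

lemma qpoch_inf_LIMSEQ:
  assumes "norm Q < 1"
  shows "(\<lambda>n. \<Prod>i<n. 1 - Q ^ i * x) \<longlonglongrightarrow> qpoch_inf x Q"
  using convergent_prod_LIMSEQ[OF convergent_prod_qpoch[OF assms, of x]]
  unfolding qpoch_inf_def LIMSEQ_lessThan_iff_atMost .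

lemma qpoch_inf_eq_0_iff:
  assumes "norm Q < 1"
  shows "qpoch_inf x Q = 0 \<longleftrightarrow> (\<exists>i. Q ^ i * x = 1)"
  using has_prod_eq_0_iff[OF convergent_prod_has_prod[OF convergent_prod_qpoch[OF assms, of x]]]
  by (auto simp: qpoch_inf_def)

lemma qpoch_inf_rec:
  assumes "norm Q < 1"
  shows "qpoch_inf x Q = (1 - x) * qpoch_inf (Q * x) Q"
proof -
  have "(\<Prod>i<Suc n. 1 - Q ^ i * x) = (1 - x) * (\<Prod>i<n. 1 - Q ^ i * (Q * x))" for n
    by (subst prod.lessThan_Suc_shift) (simp add: mult_ac)
  then have "(\<lambda>n. \<Prod>i<Suc n. 1 - Q ^ i * x) \<longlonglongrightarrow> (1 - x) * qpoch_inf (Q * x) Q"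
    using tendsto_mult[OF tendsto_const[of "1 - x"] qpoch_inf_LIMSEQ[OF assms, of "Q * x"]] by simp
  moreover have "(\<lambda>n. \<Prod>i<Suc n. 1 - Q ^ i * x) \<longlonglongrightarrow> qpoch_inf x Q"
    using qpoch_inf_LIMSEQ[OF assms] by (rule LIMSEQ_Suc)
  ultimately show ?thesis using LIMSEQ_unique by blast
qed

lemma qpoch_inf_self_nonzero:
  assumes "norm Q < 1"
  shows "qpoch_inf Q Q \<noteq> 0"
proof -
  have "Q ^ i * Q \<noteq> 1" for i
    using power_Suc_less_one[of "norm Q" i] assms
    by (metis norm_one norm_power power_Suc2 less_irrefl norm_ge_zero power_0_left power_less_one_iff zero_less_Suc)
  then show ?thesis by (simp add: qpoch_inf_eq_0_iff[OF assms])
qed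

lemma norm_power_less_one:
  fixes Q :: complex
  assumes "norm Q < 1" "k > 0"
  shows "norm (Q ^ k) < 1"
  using assms by (simp add: norm_power power_less_one_iff)

lemma qpoch_inf_mult_minus:
  assumes "norm Q < 1"
  shows "qpoch_inf x Q * qpoch_inf (- x) Q = qpoch_inf (x\<^sup>2) (Q\<^sup>2)"
proof -
  have "(\<lambda>n. (\<Prod>i<n. 1 - Q ^ i * x) * (\<Prod>i<n. 1 - Q ^ i * (- x))) \<longlonglongrightarrow> qpoch_inf x Q * qpoch_inf (- x) Q"
    by (intro tendsto_mult qpoch_inf_LIMSEQ assms)
  moreover have "(\<Prod>i<n. 1 - Q ^ i * x) * (\<Prod>i<n. 1 - Q ^ i * (- x)) = (\<Prod>i<n. 1 - (Q\<^sup>2) ^ i * x\<^sup>2)" for n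
    by (subst prod.distrib[symmetric], rule prod.cong)
       (auto simp: algebra_simps power2_eq_square power_mult_distrib)
  ultimately show ?thesis
    using qpoch_inf_LIMSEQ[OF norm_power_less_one[OF assms, of 2], of "x\<^sup>2"] LIMSEQ_unique by auto
qed

lemma qpoch_inf_split:
  assumes "norm Q < 1"
  shows "qpoch_inf x Q = qpoch_inf x (Q\<^sup>2) * qpoch_inf (Q * x) (Q\<^sup>2)"
proof -
  have Q2: "norm (Q\<^sup>2) < 1" by (rule norm_power_less_one) (use assms in auto)
  have "(\<Prod>i<2*n. 1 - Q ^ i * x)
      = (\<Prod>i<n. 1 - (Q\<^sup>2) ^ i * x) * (\<Prod>i<n. 1 - (Q\<^sup>2) ^ i * (Q * x))" for n
    by (induction n) (simp_all add: power_mult[symmetric] mult_ac)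
  then have "(\<lambda>n. \<Prod>i<2*n. 1 - Q ^ i * x) \<longlonglongrightarrow> qpoch_inf x (Q\<^sup>2) * qpoch_inf (Q * x) (Q\<^sup>2)"
    using tendsto_mult[OF qpoch_inf_LIMSEQ[OF Q2, of x] qpoch_inf_LIMSEQ[OF Q2, of "Q * x"]] by simp
  moreover have "(\<lambda>n. \<Prod>i<2*n. 1 - Q ^ i * x) \<longlonglongrightarrow> qpoch_inf x Q"
    using LIMSEQ_subseq_LIMSEQ[OF qpoch_inf_LIMSEQ[OF assms, of x], of "\<lambda>n. 2*n"]
    by (simp add: strict_mono_def o_def)
  ultimately show ?thesis using LIMSEQ_unique by blast
qed

lemma qpoch_inf_holomorphic:
  assumes "norm Q < 1"
  shows "(\<lambda>x. qpoch_inf x Q) holomorphic_on UNIV"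
proof -
  have *: "uniform_limit (cball 0 r) (\<lambda>n x. \<Prod>i<n. 1 - Q ^ i * x) (\<lambda>x. qpoch_inf x Q) sequentially"
    for r
  proof -
    have "uniformly_convergent_on (cball 0 r) (\<lambda>n x. \<Prod>i<n. 1 - Q ^ i * x)"
    proof (rule uniformly_convergent_on_prod')
      show "uniformly_convergent_on (cball 0 r) (\<lambda>N x. \<Sum>n<N. norm (1 - Q ^ n * x - 1))"
      proof (rule Weierstrass_m_test')
        show "summable (\<lambda>n. norm Q ^ n * r)"
          using assms by (intro summable_mult2 summable_geometric) auto
      qed (auto simp: norm_mult norm_power intro!: mult_left_mono)
    qed (auto intro!: continuous_intros)
    then obtain l where l: "uniform_limit (cball 0 r) (\<lambda>n x. \<Prod>i<n. 1 - Q ^ i * x) l sequentially"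
      by (auto simp: uniformly_convergent_on_def)
    have "l x = qpoch_inf x Q" if "x \<in> cball 0 r" for x
      using tendsto_uniform_limitI[OF l that] qpoch_inf_LIMSEQ[OF assms, of x] LIMSEQ_unique by blast
    then show ?thesis
      using uniform_limit_cong'[of "cball 0 r" _ _ l] l by (metis (no_types, lifting))
  qed
  have "(\<lambda>x. qpoch_inf x Q) holomorphic_on ball 0 r" for r
    by (rule holomorphic_uniform_limit[OF _ *[of r]])
       (auto intro!: always_eventually holomorphic_intros continuous_intros)
  then have "(\<lambda>x. qpoch_inf x Q) field_differentiable (at x)" for x
    by (meson holomorphic_on_imp_differentiable_at open_ball mem_ball_0 less_add_one)
  then show ?thesis
    by (simp add: holomorphic_on_def field_differentiable_at_within)
qed

section \<open>Functional equations and zeros of the theta function\<close>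

lemma qTheta_shift:
  assumes "norm Q < 1" "Q \<noteq> 0" "x \<noteq> 0"
  shows "qTheta (Q * x) Q = - qTheta x Q / x"
proof -
  have "qTheta (Q * x) Q = qpoch_inf (Q * x) Q * ((1 - 1 / x) * qpoch_inf (Q / x) Q) * qpoch_inf Q Q"
    using qpoch_inf_rec[OF assms(1), of "1 / x"] assms by (simp add: qTheta_def)
  also have "1 - 1 / x = - (1 - x) / x"
    using assms by (simp add: field_simps)
  also have "qpoch_inf (Q * x) Q * (- (1 - x) / x * qpoch_inf (Q / x) Q) * qpoch_inf Q Q
      = - qTheta x Q / x"
    unfolding qTheta_def qpoch_inf_rec[OF assms(1), of x] using assms by (simp add: field_simps)
  finally show ?thesis .
qed

lemma qTheta_reflect:
  assumes "Q \<noteq> 0"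
  shows "qTheta (Q / x) Q = qTheta x Q"
  using assms by (simp add: qTheta_def)

lemma qTheta_inverse:
  assumes "norm Q < 1" "Q \<noteq> 0" "x \<noteq> 0"
  shows "qTheta (1 / x) Q = - qTheta x Q / x"
proof -
  have "qTheta (1 / x) Q = qTheta (Q / (Q * x)) Q"
    using assms by simp
  also have "\<dots> = qTheta (Q * x) Q"
    using assms by (intro qTheta_reflect) auto
  finally show ?thesis using qTheta_shift[OF assms] by simp
qed

lemma qTheta_one: "qTheta 1 Q = 0" if "norm Q < 1"
  using qpoch_inf_rec[OF that, of 1] by (simp add: qTheta_def)

text \<open>
  A zero of the product is a zero of one factor. Conversely \<open>x = 1\<close> is a zero, and the functional
  equation propagates it to all integer powers of \<open>Q\<close>.
\<close>
lemma qTheta_eq_0_iff: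
  assumes "norm Q < 1" "Q \<noteq> 0" "x \<noteq> 0"
  shows "qTheta x Q = 0 \<longleftrightarrow> (\<exists>n::int. x = Q powi n)"
proof
  assume "qTheta x Q = 0"
  then have "qpoch_inf x Q = 0 \<or> qpoch_inf (Q / x) Q = 0"
    using qpoch_inf_self_nonzero[OF assms(1)] by (auto simp: qTheta_def)
  then show "\<exists>n::int. x = Q powi n"
  proof
    assume "qpoch_inf x Q = 0"
    then obtain i where "Q ^ i * x = 1" using qpoch_inf_eq_0_iff[OF assms(1)] by blast
    then have "x = Q powi (- int i)"
      using assms by (simp add: power_int_minus field_simps)
    then show ?thesis ..
  next
    assume "qpoch_inf (Q / x) Q = 0"
    then obtain i where "Q ^ i * (Q / x) = 1" using qpoch_inf_eq_0_iff[OF assms(1)] by blast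
    then have "x = Q powi (int (Suc i))"
      using assms unfolding power_int_of_nat by (simp add: field_simps)
    then show ?thesis ..
  qed
next
  have step: "qTheta (Q powi n) Q = 0 \<longleftrightarrow> qTheta (Q powi (n + 1)) Q = 0" for n :: int
    using qTheta_shift[OF assms(1,2), of "Q powi n"] assms(2) by (simp add: power_int_add mult.commute)
  have "qTheta (Q powi n) Q = 0" for n :: int
  proof (induction n rule: int_induct[of _ 0])
    case base
    then show ?case using qTheta_one[OF assms(1)] by simp
  next
    case (step1 i)
    then show ?case using step by blast
  next
    case (step2 i)
    then show ?case using step[of "i - 1"] by simp
  qed
  then show "\<exists>n::int. x = Q powi n \<Longrightarrow> qTheta x Q = 0" by blast
qed

lemma qTheta_holomorphic:
  assumes "norm Q < 1" "f holomorphic_on S" "\<And>z. z \<in> S \<Longrightarrow> f z \<noteq> 0"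
  shows "(\<lambda>z. qTheta (f z) Q) holomorphic_on S"
proof -
  have *: "(\<lambda>z. qpoch_inf (g z) Q) holomorphic_on S" if "g holomorphic_on S" for g
    using holomorphic_on_compose_gen[OF that qpoch_inf_holomorphic[OF assms(1)]]
    by (simp add: o_def)
  show ?thesis
    unfolding qTheta_def by (intro holomorphic_intros * assms(2,3))
qed

text \<open>
  At \<open>x = 1\<close> only the factor \<open>1 - x\<close> vanishes. Differentiating the functional equation
  \<open>\<Theta>(Q x) = - \<Theta>(x) / x\<close> at a zero shows that the derivatives at \<open>x\<close> and at \<open>Q x\<close> vanish together,
  so simplicity spreads from 1 to every power of \<open>Q\<close>.
\<close>
lemma qTheta_simple_zero:
  assumes "norm Q < 1" "Q \<noteq> 0" "x \<noteq> 0" "qTheta x Q = 0"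
  shows "\<exists>D. ((\<lambda>x. qTheta x Q) has_field_derivative D) (at x) \<and> D \<noteq> 0"
proof -
  let ?P = "\<lambda>x. \<exists>D. ((\<lambda>x. qTheta x Q) has_field_derivative D) (at x) \<and> D \<noteq> 0"
  have at_one: "?P 1"
  proof -
    define u where "u = (\<lambda>x. qpoch_inf (Q * x) Q * qpoch_inf (Q / x) Q * qpoch_inf Q Q)"
    have *: "(\<lambda>z. qpoch_inf (g z) Q) holomorphic_on -{0}" if "g holomorphic_on -{0}" for g
      using holomorphic_on_compose_gen[OF that qpoch_inf_holomorphic[OF assms(1)]]
      by (simp add: o_def)
    have "u holomorphic_on -{0}"
      unfolding u_def by (intro holomorphic_intros *) auto
    then obtain D where D: "(u has_field_derivative D) (at 1)"
      using holomorphic_derivI[of u "-{0}" 1] by (auto simp: open_Compl)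
    have "((\<lambda>x. 1 - x) has_field_derivative - 1) (at (1::complex))"
      by (auto intro!: derivative_eq_intros)
    from DERIV_mult'[OF this D]
    have "((\<lambda>x. (1 - x) * u x) has_field_derivative - u 1) (at 1)"
      by simp
    moreover have "(\<lambda>x. (1 - x) * u x) = (\<lambda>x. qTheta x Q)"
    proof
      fix x :: complex
      show "(1 - x) * u x = qTheta x Q"
        unfolding u_def qTheta_def qpoch_inf_rec[OF assms(1), of x] by simp
    qed
    ultimately show ?thesis
      using qpoch_inf_self_nonzero[OF assms(1)] by (intro exI[of _ "- u 1"]) (auto simp: u_def)
  qed
  have up: "?P (Q * x)" if x: "x \<noteq> 0" "qTheta x Q = 0" and P: "?P x" for x
  proof -
    from P obtain D where D: "((\<lambda>x. qTheta x Q) has_field_derivative D) (at x)" "D \<noteq> 0" by blast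
    have 1: "((\<lambda>y. y / Q) has_field_derivative 1 / Q) (at (Q * x))"
      by (rule DERIV_cdivide DERIV_ident)+
    have 2: "((\<lambda>y. qTheta (y / Q) Q) has_field_derivative D * (1 / Q)) (at (Q * x))"
      by (rule DERIV_chain2[OF _ 1]) (use D assms in simp)
    have 3: "((\<lambda>y. - (Q / y)) has_field_derivative 1 / (Q * x\<^sup>2)) (at (Q * x))"
      using assms x by (auto intro!: derivative_eq_intros simp: power2_eq_square)
    have 4: "((\<lambda>y. - (Q / y) * qTheta (y / Q) Q) has_field_derivative - D / (Q * x)) (at (Q * x))"
      by (rule DERIV_cong[OF DERIV_mult'[OF 3 2]]) (use assms x in simp)
    have eq: "- (Q / y) * qTheta (y / Q) Q = qTheta y Q" if "y \<in> -{0}" for y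
    proof -
      have "qTheta y Q = qTheta (Q * (y / Q)) Q" using assms by simp
      also have "\<dots> = - qTheta (y / Q) Q / (y / Q)"
        using assms that by (intro qTheta_shift) auto
      finally show ?thesis by simp
    qed
    have "((\<lambda>x. qTheta x Q) has_field_derivative - D / (Q * x)) (at (Q * x))"
      by (rule has_field_derivative_transform_within_open[where S = "-{0}", OF 4 _ _ eq]) (use assms x in \<open>auto simp: open_Compl\<close>)
    moreover have "- D / (Q * x) \<noteq> 0" using D x assms by simp
    ultimately show ?thesis by blast
  qed
  have down: "?P x" if x: "x \<noteq> 0" "qTheta x Q = 0" and P: "?P (Q * x)" for x
  proof -
    from P obtain D where D: "((\<lambda>x. qTheta x Q) has_field_derivative D) (at (Q * x))" "D \<noteq> 0" by blast
    have 1: "((\<lambda>y. Q * y) has_field_derivative Q) (at x)"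
      by (rule DERIV_cmult_Id)
    have 2: "((\<lambda>y. qTheta (Q * y) Q) has_field_derivative D * Q) (at x)"
      by (rule DERIV_chain2[OF D(1) 1])
    have 3: "((\<lambda>y. - y) has_field_derivative - 1) (at x)"
      by (rule DERIV_minus DERIV_ident)+
    have "qTheta (Q * x) Q = 0"
      using qTheta_shift[OF assms(1,2), of x] x by simp
    then have 4: "((\<lambda>y. - y * qTheta (Q * y) Q) has_field_derivative - x * (D * Q)) (at x)"
      using DERIV_mult'[OF 3 2] by simp
    have eq: "- y * qTheta (Q * y) Q = qTheta y Q" if "y \<in> -{0}" for y
      using that by (subst qTheta_shift[OF assms(1,2)]) auto
    have "((\<lambda>x. qTheta x Q) has_field_derivative - x * (D * Q)) (at x)"
      by (rule has_field_derivative_transform_within_open[where S = "-{0}", OF 4 _ _ eq]) (use x in \<open>auto simp: open_Compl\<close>)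
    moreover have "- x * (D * Q) \<noteq> 0" using D x assms by simp
    ultimately show ?thesis by blast
  qed
  have z: "qTheta (Q powi n) Q = 0" "Q powi n \<noteq> 0" for n :: int
    using qTheta_eq_0_iff[OF assms(1,2), of "Q powi n"] assms(2) by auto
  have "?P (Q powi n)" for n :: int
  proof (induction n rule: int_induct[of _ 0])
    case base
    then show ?case using at_one by simp
  next
    case (step1 i)
    then show ?case using up[OF z(2,1)] assms(2) by (simp add: power_int_add mult.commute)
  next
    case (step2 i)
    have "Q * Q powi (i - 1) = Q powi i"
      using assms(2) by (simp add: power_int_diff)
    then show ?case using down[OF z(2,1), of "i - 1"] step2 by simp
  qed
  then show ?thesis
    using qTheta_eq_0_iff[OF assms(1-3)] assms(4) by blast
qed

text \<open>
  Duplication in the argument: pair the factors \<open>1 - Q\<^sup>i x\<close> and \<open>1 + Q\<^sup>i x\<close>.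
\<close>
lemma qTheta_mult_minus:
  assumes "norm Q < 1"
  shows "qTheta x Q * qTheta (- x) Q * qpoch_inf (Q\<^sup>2) (Q\<^sup>2) = qTheta (x\<^sup>2) (Q\<^sup>2) * (qpoch_inf Q Q)\<^sup>2"
proof -
  have "qTheta x Q * qTheta (- x) Q * qpoch_inf (Q\<^sup>2) (Q\<^sup>2)
      = (qpoch_inf x Q * qpoch_inf (- x) Q) * (qpoch_inf (Q / x) Q * qpoch_inf (- (Q / x)) Q)
        * qpoch_inf (Q\<^sup>2) (Q\<^sup>2) * (qpoch_inf Q Q)\<^sup>2"
    by (simp add: qTheta_def power2_eq_square)
  also have "\<dots> = qTheta (x\<^sup>2) (Q\<^sup>2) * (qpoch_inf Q Q)\<^sup>2"
    by (simp add: qpoch_inf_mult_minus[OF assms] qTheta_def power_divide)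
  finally show ?thesis .
qed

text \<open>
  Duplication in the base: separate the even from the odd powers of \<open>Q\<close>.
\<close>
lemma qTheta_split:
  assumes "norm Q < 1" "Q \<noteq> 0"
  shows "qTheta x (Q\<^sup>2) * qTheta (Q * x) (Q\<^sup>2) * qpoch_inf Q Q = qTheta x Q * (qpoch_inf (Q\<^sup>2) (Q\<^sup>2))\<^sup>2"
proof -
  have "Q\<^sup>2 / (Q * x) = Q / x" "Q * (Q / x) = Q\<^sup>2 / x"
    using assms by (simp_all add: power2_eq_square)
  then show ?thesis
    using qpoch_inf_split[OF assms(1), of x] qpoch_inf_split[OF assms(1), of "Q / x"]
    unfolding qTheta_def by (simp add: power2_eq_square mult_ac)
qed

lemma qTheta_deriv_nonzero:
  assumes "norm Q < 1" "Q \<noteq> 0" "x \<noteq> 0" "qTheta x Q = 0"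
  shows "deriv (\<lambda>x. qTheta x Q) x \<noteq> 0"
  using qTheta_simple_zero[OF assms] DERIV_imp_deriv by blast

lemma qTheta_minus_one:
  assumes "norm Q < 1"
  shows "qTheta (-1) Q * qpoch_inf Q Q = 2 * (qpoch_inf (Q\<^sup>2) (Q\<^sup>2))\<^sup>2"
proof -
  have "qpoch_inf (-1) Q = 2 * qpoch_inf (-Q) Q"
    using qpoch_inf_rec[OF assms, of "-1"] by simp
  then have "qTheta (-1) Q * qpoch_inf Q Q = 2 * (qpoch_inf Q Q * qpoch_inf (-Q) Q)\<^sup>2"
    by (simp add: qTheta_def power2_eq_square)
  then show ?thesis
    by (simp add: qpoch_inf_mult_minus[OF assms])
qed

section \<open>Quasi-periodic holomorphic functions with prescribed zeros\<close>

lemma eventually_nonzero_of_simple_zeros: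
  assumes "open S" "P holomorphic_on S" "w \<in> S" "P w = 0 \<Longrightarrow> deriv P w \<noteq> 0"
  shows "\<forall>\<^sub>F z in at w. P z \<noteq> 0"
proof (cases "P w = 0")
  case True
  have "((\<lambda>z. (P z - P w) / (z - w)) \<longlongrightarrow> deriv P w) (at w)"
    using holomorphic_derivI[OF assms(2,1,3)] by (simp add: has_field_derivative_iff)
  from tendsto_imp_eventually_ne[OF this assms(4)[OF True]]
  show ?thesis
    by eventually_elim (use True in auto)
next
  case False
  have "(P \<longlongrightarrow> P w) (at w)"
    using holomorphic_on_imp_continuous_on[OF assms(2)] assms(1,3)
    by (simp add: continuous_on_eq_continuous_at isCont_def)
  from tendsto_imp_eventually_ne[OF this False] show ?thesis .
qed

text \<open>
  At a zero \<open>w\<close> of \<open>P\<close> the difference quotients of \<open>f\<close> and \<open>P\<close> converge, the latter to a nonzero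
  limit. So \<open>f / P\<close> tends to \<open>f'(w) / P'(w)\<close>, and the singularity is removable.
\<close>
lemma holomorphic_quotient_simple_zeros:
  assumes S: "open S" and f: "f holomorphic_on S" and P: "P holomorphic_on S"
    and zeros: "\<And>w. w \<in> S \<Longrightarrow> P w = 0 \<Longrightarrow> f w = 0 \<and> deriv P w \<noteq> 0"
  obtains g where "g holomorphic_on S" "\<And>z. z \<in> S \<Longrightarrow> f z = P z * g z"
proof -
  define g where "g = (\<lambda>z. if P z = 0 then deriv f z / deriv P z else f z / P z)"
  have "g field_differentiable at w" if w: "w \<in> S" for w
  proof -
    have ev: "\<forall>\<^sub>F z in at w. P z \<noteq> 0"
      by (rule eventually_nonzero_of_simple_zeros[OF S P w]) (use zeros[OF w] in blast)
    obtain r where r: "r > 0" "ball w r \<subseteq> S" "\<And>z. z \<in> ball w r - {w} \<Longrightarrow> P z \<noteq> 0"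
    proof -
      from ev obtain d where d: "d > 0" "\<And>z. z \<noteq> w \<Longrightarrow> dist z w < d \<Longrightarrow> P z \<noteq> 0"
        by (auto simp: eventually_at)
      moreover obtain e where "e > 0" "ball w e \<subseteq> S" using S w open_contains_ball by blast
      ultimately show ?thesis
        by (intro that[of "min d e"]) (auto simp: dist_commute)
    qed
    have quot: "(\<lambda>z. f z / P z) holomorphic_on ball w r - {w}"
      by (intro holomorphic_on_divide holomorphic_on_subset[OF f] holomorphic_on_subset[OF P])
         (use r in auto)
    then have hol: "g holomorphic_on ball w r - {w}"
      by (rule holomorphic_transform) (use r(3) in \<open>auto simp: g_def\<close>)
    have ev': "\<forall>\<^sub>F z in at w. z \<in> ball w r - {w}"
      using r(1) by (intro eventually_at_in_open) auto
    have "(g \<longlongrightarrow> g w) (at w)"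
    proof (cases "P w = 0")
      case True
      have fw: "f w = 0" and dP: "deriv P w \<noteq> 0" using zeros[OF w True] by auto
      have "((\<lambda>z. ((f z - f w) / (z - w)) / ((P z - P w) / (z - w))) \<longlongrightarrow> deriv f w / deriv P w) (at w)"
        using holomorphic_derivI[OF P S w] holomorphic_derivI[OF f S w] dP
        by (intro tendsto_divide) (simp_all add: has_field_derivative_iff)
      also have "deriv f w / deriv P w = g w" using True by (simp add: g_def)
      finally have lim: "((\<lambda>z. ((f z - f w) / (z - w)) / ((P z - P w) / (z - w))) \<longlongrightarrow> g w) (at w)" .
      from ev' have "\<forall>\<^sub>F z in at w. ((f z - f w) / (z - w)) / ((P z - P w) / (z - w)) = g z"
        by eventually_elim (use r(3) True fw in \<open>auto simp: g_def\<close>)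
      then show ?thesis by (rule Lim_transform_eventually[OF lim])
    next
      case False
      have "((\<lambda>z. f z / P z) \<longlongrightarrow> f w / P w) (at w)"
        using holomorphic_on_imp_continuous_on[OF P] holomorphic_on_imp_continuous_on[OF f] S w False
        by (intro tendsto_divide) (simp_all add: continuous_on_eq_continuous_at isCont_def)
      also have "f w / P w = g w" using False by (simp add: g_def)
      finally have lim: "((\<lambda>z. f z / P z) \<longlongrightarrow> g w) (at w)" .
      from ev' have "\<forall>\<^sub>F z in at w. f z / P z = g z"
        by eventually_elim (use r(3) in \<open>auto simp: g_def\<close>)
      then show ?thesis by (rule Lim_transform_eventually[OF lim])
    qed
    then have "(g \<longlongrightarrow> g z) (at z within ball w r)" if "z \<in> {w}" for z
      using that by (simp add: Lim_at_imp_Lim_at_within)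
    then have "g holomorphic_on ball w r"
      by (rule no_isolated_singularity'[OF _ hol]) auto
    then show ?thesis
      by (rule holomorphic_on_imp_differentiable_at) (use r(1) in auto)
  qed
  then have "g holomorphic_on S"
    by (simp add: holomorphic_on_def field_differentiable_at_within)
  moreover have "f z = P z * g z" if "z \<in> S" for z
    using zeros[OF that] by (auto simp: g_def)
  ultimately show ?thesis by (rule that)
qed

text \<open>
  Taking logarithms of norms turns multiplication by \<open>Q\<close> into a translation of the line, with the
  annulus as a closed fundamental interval.
\<close>
lemma annulus_representative:
  fixes Q z :: complex
  assumes "norm Q < 1" "Q \<noteq> 0" "z \<noteq> 0"
  obtains n :: int where "norm Q \<le> norm (Q powi n * z)" "norm (Q powi n * z) \<le> 1"
proof -
  define L where "L = ln (norm Q)"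
  have L: "L < 0" using assms by (simp add: L_def)
  \<comment> \<open>As \<open>L < 0\<close>, rounding up the solution of \<open>n L + ln (norm z) = 0\<close> gives a value in \<open>[L, 0]\<close>.\<close>
  define n where "n = \<lceil>- ln (norm z) / L\<rceil>"
  have lnn: "ln (norm (Q powi n * z)) = of_int n * L + ln (norm z)"
  proof -
    have "norm Q powi n = exp (of_int n * L)"
      using assms exp_power_int[of L n] by (simp add: L_def mult.commute)
    then show ?thesis
      using assms by (simp add: norm_mult norm_power_int ln_mult)
  qed
  have "- ln (norm z) / L \<le> of_int n" "of_int n < - ln (norm z) / L + 1"
    unfolding n_def by linarith+
  then have "of_int n * L + ln (norm z) \<le> 0" "of_int n * L + ln (norm z) \<ge> L"
    using L by (auto simp: field_simps)
  then have "ln (norm (Q powi n * z)) \<le> ln 1" "ln (norm Q) \<le> ln (norm (Q powi n * z))"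
    using lnn by (simp_all add: L_def)
  moreover have "norm (Q powi n * z) > 0" "norm Q > 0" using assms by auto
  ultimately show ?thesis
    by (intro that[of n]) (simp_all only: ln_le_cancel_iff zero_less_one)
qed

lemma multiplicatively_periodic:
  fixes g :: "complex \<Rightarrow> 'a"
  assumes "Q \<noteq> 0" "\<And>z. z \<noteq> 0 \<Longrightarrow> g (Q * z) = g z" "z \<noteq> 0"
  shows "g (Q powi n * z) = g z"
proof (induction n rule: int_induct[of _ 0])
  case base
  then show ?case by simp
next
  case (step1 i)
  have "Q powi (i + 1) * z = Q * (Q powi i * z)"
    using assms(1) by (simp add: power_int_add mult_ac)
  also have "g \<dots> = g (Q powi i * z)"
    using assms(1,3) by (intro assms(2)) auto
  finally show ?case using step1 by simp
next
  case (step2 i)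
  have "Q powi i * z = Q * (Q powi (i - 1) * z)"
    using assms(1) by (simp add: power_int_diff)
  then have "g (Q powi i * z) = g (Q * (Q powi (i - 1) * z))" by (rule arg_cong)
  also have "\<dots> = g (Q powi (i - 1) * z)"
    using assms(1,3) by (intro assms(2)) auto
  finally show ?case using step2 by simp
qed

text \<open>
  The pullback \<open>g \<circ> exp\<close> is entire, which disposes of the puncture at 0 without any study of the
  singularity there, and it is bounded by the maximum of \<open>g\<close> on a compact annulus.
\<close>
lemma multiplicatively_periodic_holomorphic_constant:
  assumes Q: "norm Q < 1" "Q \<noteq> 0"
    and g: "g holomorphic_on -{0}" and per: "\<And>z. z \<noteq> 0 \<Longrightarrow> g (Q * z) = g z"
  obtains c where "\<And>z. z \<noteq> 0 \<Longrightarrow> g z = c"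
proof -
  define K where "K = cball (0::complex) 1 - ball 0 (norm Q)"
  have "compact K" unfolding K_def by (intro compact_diff compact_cball open_ball)
  moreover have sub: "K \<subseteq> -{0}" using Q by (auto simp: K_def)
  ultimately have "bounded (g ` K)"
    using holomorphic_on_imp_continuous_on[OF holomorphic_on_subset[OF g sub]]
    by (intro compact_imp_bounded compact_continuous_image)
  then obtain B where B: "\<And>z. z \<in> K \<Longrightarrow> norm (g z) \<le> B" by (auto simp: bounded_iff)
  have bd: "norm (g z) \<le> B" if z: "z \<noteq> 0" for z
  proof -
    obtain n where "norm Q \<le> norm (Q powi n * z)" "norm (Q powi n * z) \<le> 1"
      by (rule annulus_representative[OF Q z])
    then have "Q powi n * z \<in> K" by (simp add: K_def)
    then show ?thesis using B multiplicatively_periodic[of Q g z, OF Q(2) per z] by metis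
  qed
  have "(g \<circ> exp) holomorphic_on UNIV"
    using g by (intro holomorphic_on_compose_gen[of exp UNIV g "-{0}"] holomorphic_intros) auto
  moreover have "norm ((g \<circ> exp) w) \<le> B * norm w ^ 0" for w
    using bd by simp
  ultimately have "(g \<circ> exp) w = (\<Sum>k\<le>0. (deriv^^k) (g \<circ> exp) 0 / fact k * w ^ k)" for w
    by (rule Liouville_polynomial)
  then have "g (exp w) = g 1" for w by simp
  then have "g z = g 1" if "z \<noteq> 0" for z using exp_Ln[OF that] by (metis (no_types))
  then show ?thesis by (rule that)
qed

text \<open>
  The quotient of two functions with the same multiplier is \<open>Q\<close>-periodic. At zeros of \<open>P\<close>, where the
  multiplier cannot be cancelled, periodicity follows from neighbouring points by continuity.
\<close>
lemma quasi_periodic_proportional: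
  assumes Q: "norm Q < 1" "Q \<noteq> 0"
    and f: "f holomorphic_on -{0}" and P: "P holomorphic_on -{0}"
    and fper: "\<And>z. z \<noteq> 0 \<Longrightarrow> f (Q * z) = \<mu> z * f z"
    and Pper: "\<And>z. z \<noteq> 0 \<Longrightarrow> P (Q * z) = \<mu> z * P z"
    and mu: "\<And>z. z \<noteq> 0 \<Longrightarrow> \<mu> z \<noteq> 0"
    and zeros: "\<And>z. z \<noteq> 0 \<Longrightarrow> P z = 0 \<Longrightarrow> f z = 0 \<and> deriv P z \<noteq> 0"
  obtains c where "\<And>z. z \<noteq> 0 \<Longrightarrow> f z = c * P z"
proof -
  obtain g where g: "g holomorphic_on -{0}" and fg: "\<And>z. z \<in> -{0} \<Longrightarrow> f z = P z * g z"
    by (rule holomorphic_quotient_simple_zeros[OF _ f P]) (use zeros in \<open>auto simp: open_Compl\<close>)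
  have "g (Q * z) = g z" if z: "z \<noteq> 0" for z
  proof -
    have cont: "continuous_on (-{0}) (\<lambda>z. g (Q * z) - g z)"
      using Q g by (intro continuous_intros holomorphic_on_imp_continuous_on
          holomorphic_on_compose_gen[unfolded o_def, OF _ g] holomorphic_intros) auto
    have nz: "\<forall>\<^sub>F w in at z. P w \<noteq> 0"
      by (rule eventually_nonzero_of_simple_zeros[OF _ P]) (use z zeros[OF z] in \<open>auto simp: open_Compl\<close>)
    moreover have "\<forall>\<^sub>F w in at z. w \<in> -{0} - {z}"
      using z by (intro eventually_at_in_open) auto
    ultimately have "\<forall>\<^sub>F w in at z. g (Q * w) - g w = 0"
    proof eventually_elim
      case (elim w)
      have "P (Q * w) * g (Q * w) = \<mu> w * (P w * g w)"
        using fg[of "Q * w"] fg[of w] fper[of w] elim Q by auto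
      then show ?case using Pper[of w] mu[of w] elim by auto
    qed
    then have "((\<lambda>w. g (Q * w) - g w) \<longlongrightarrow> 0) (at z)"
      by (rule tendsto_eventually)
    moreover have "((\<lambda>w. g (Q * w) - g w) \<longlongrightarrow> g (Q * z) - g z) (at z)"
      using cont z by (simp add: continuous_on_eq_continuous_at isCont_def open_Compl)
    ultimately show ?thesis
      using tendsto_unique[OF at_neq_bot] by fastforce
  qed
  then obtain c where "\<And>z. z \<noteq> 0 \<Longrightarrow> g z = c"
    using multiplicatively_periodic_holomorphic_constant[OF Q g] by blast
  then show ?thesis using fg by (intro that[of c]) auto
qed

text \<open>
  The zero set of a quasi-periodic function is periodic; the instance of
  \<open>multiplicatively_periodic\<close> for the predicate \<open>f z = 0\<close>.
\<close>
lemma quasi_periodic_zero_shift: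
  assumes Q: "Q \<noteq> (0::complex)"
    and fper: "\<And>z. z \<noteq> 0 \<Longrightarrow> f (Q * z) = \<mu> z * f z" and mu: "\<And>z. z \<noteq> 0 \<Longrightarrow> \<mu> z \<noteq> (0::complex)"
    and z: "z \<noteq> 0"
  shows "f (Q powi n * z) = 0 \<longleftrightarrow> f z = 0"
  using multiplicatively_periodic[of Q "\<lambda>z. f z = 0" z n] assms by simp

section \<open>The sum, its denominators, and the product that carries its zeros\<close>

definition summand0 :: "complex \<Rightarrow> complex \<Rightarrow> complex" where
  "summand0 q z = - q * z powi (-3) *
     (qTheta (- (q ^ 2) * z ^ 3) (q ^ 4) * qTheta (z ^ 12) (q ^ 16) / qTheta z (q ^ 4))"

definition summand1 :: "complex \<Rightarrow> complex \<Rightarrow> complex" where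
  "summand1 q z = z ^ 5 *
     (qTheta (- q * z ^ 3) (q ^ 4) * qTheta (q ^ 12 * z ^ 12) (q ^ 16) / qTheta (q * z) (q ^ 4))"

definition summand2 :: "complex \<Rightarrow> complex \<Rightarrow> complex" where
  "summand2 q z = z *
     (qTheta (- (z ^ 3)) (q ^ 4) * qTheta (q ^ 8 * z ^ 12) (q ^ 16) / qTheta (q ^ 2 * z) (q ^ 4))"

definition summand3 :: "complex \<Rightarrow> complex \<Rightarrow> complex" where
  "summand3 q z =
     qTheta (- (q ^ 3) * z ^ 3) (q ^ 4) * qTheta (q ^ 4 * z ^ 12) (q ^ 16) / qTheta (q ^ 3 * z) (q ^ 4)"

definition theta_sum :: "complex \<Rightarrow> complex \<Rightarrow> complex" where
  "theta_sum q z = summand0 q z + summand1 q z + summand2 q z + summand3 q z"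

lemmas summand_defs = summand0_def summand1_def summand2_def summand3_def

lemma power_int_minus3: "z powi (-3) = 1 / z ^ 3" for z :: complex
  by (simp add: power_int_minus inverse_eq_divide)

definition theta_den :: "complex \<Rightarrow> complex \<Rightarrow> complex" where
  "theta_den q z = qTheta z (q ^ 4) * qTheta (q * z) (q ^ 4) * qTheta (q ^ 2 * z) (q ^ 4) * qTheta (q ^ 3 * z) (q ^ 4)"

text \<open>
  The product of all theta functions on the right-hand side with the four denominators, up to a factor
  that does not depend on \<open>z\<close>; see \<open>theta_den_eq\<close> and \<open>theta_prod_eq\<close>.
\<close>
definition theta_prod :: "complex \<Rightarrow> complex \<Rightarrow> complex" where
  "theta_prod q z = qTheta (- (z ^ 4)) (q ^ 2) * qTheta (z ^ 2) q"

lemma int_div2_cases: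
  obtains m r :: int where "n = 2 * m + r" "r = 0 \<or> r = 1"
proof
  show "n = 2 * (n div 2) + n mod 2" by simp
  show "n mod 2 = 0 \<or> n mod 2 = 1" by presburger
qed

context
  fixes q :: complex
  assumes q: "0 < norm q" "norm q < 1"
begin

lemma q_nonzero: "q \<noteq> 0" using q by auto

lemma q_power_nome: "k > 0 \<Longrightarrow> norm (q ^ k) < 1" "q ^ k \<noteq> 0"
  using norm_power_less_one[OF q(2)] q_nonzero by auto

lemma qpoch_inf_q_power_nonzero: "k > 0 \<Longrightarrow> qpoch_inf (q ^ k) (q ^ k) \<noteq> 0"
  using q_power_nome qpoch_inf_self_nonzero by blast

lemma qTheta_shiftI:
  assumes "y = q ^ k * x" "k > 0" "x \<noteq> 0"
  shows "qTheta y (q ^ k) = - qTheta x (q ^ k) / x"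
  unfolding assms(1) using q_power_nome assms(2,3) by (intro qTheta_shift)

lemma qTheta_inverseI:
  assumes "y = 1 / x" "k > 0" "x \<noteq> 0"
  shows "qTheta y (q ^ k) = - qTheta x (q ^ k) / x"
  unfolding assms(1) using q_power_nome assms(2,3) by (intro qTheta_inverse)

lemma qTheta_reflectI:
  assumes "y = q ^ k / x"
  shows "qTheta y (q ^ k) = qTheta x (q ^ k)"
  unfolding assms(1) using q_nonzero by (intro qTheta_reflect) simp

section \<open>Quadratic relations between theta functions\<close>

text \<open>
  As functions of \<open>x\<close>, both sides are multiplied by \<open>- 1 / x\<close> under \<open>x \<mapsto> q\<^sup>2 x\<close>. The right-hand side
  has its zeros at the powers of \<open>q\<^sup>2\<close>, and the left-hand side vanishes at \<open>x = 1\<close> because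
  \<open>\<Theta>(q; q\<^sup>4) = \<Theta>(q\<^sup>3; q\<^sup>4)\<close>. Hence the sides are proportional; the factor is found at \<open>x = -1\<close>, where
  the two squares on the left are equal and add up.
\<close>
lemma qTheta_square_difference:
  assumes x: "x \<noteq> 0"
  shows "(qTheta (q * x) (q^4))\<^sup>2 - x * (qTheta (q^3 * x) (q^4))\<^sup>2 = qTheta x (q^2) * qTheta (-q) (q^2)"
proof -
  note nz = q_nonzero
  define f where "f = (\<lambda>x. (qTheta (q * x) (q^4))\<^sup>2 - x * (qTheta (q^3 * x) (q^4))\<^sup>2)"
  have fper: "f (q^2 * z) = (- 1 / z) * f z" if z: "z \<noteq> 0" for z
  proof -
    have 1: "q * (q^2 * z) = q^3 * z" "q^3 * (q^2 * z) = q^4 * (q * z)"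
      by (simp_all add: power_numeral_reduce)
    have 2: "qTheta (q^4 * (q * z)) (q^4) = - qTheta (q * z) (q^4) / (q * z)"
      by (rule qTheta_shift) (use q_power_nome[of 4] nz z in auto)
    show ?thesis
      unfolding f_def 1 2 using nz z by (simp add: field_simps power2_eq_square)
  qed
  have Pper: "qTheta (q^2 * z) (q^2) = (- 1 / z) * qTheta z (q^2)" if "z \<noteq> 0" for z
    using qTheta_shift[OF q_power_nome, of 2 z] that by simp
  have refl: "qTheta (q^3 * u) (q^4) = qTheta (q * u) (q^4)" if "u * u = 1" for u
  proof -
    have u: "u \<noteq> 0" "1 / u = u" using that by (auto simp: divide_eq_eq)
    have "q^4 / (q * u) = q^3 * (1 / u)" using nz u(1) by (simp add: field_simps power_numeral_reduce)
    then have "q^4 / (q * u) = q^3 * u" by (simp only: u(2))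
    then show ?thesis using qTheta_reflect[OF q_power_nome(2), of 4 "q * u"] by simp
  qed
  have f1: "f 1 = 0"
    using refl[of 1] by (simp add: f_def)
  obtain c where c: "\<And>z. z \<noteq> 0 \<Longrightarrow> f z = c * qTheta z (q^2)"
  proof (rule quasi_periodic_proportional[OF q_power_nome(1)[of 2] q_power_nome(2)[of 2], of f "\<lambda>z. qTheta z (q^2)" "\<lambda>z. - 1 / z"])
    show "f holomorphic_on - {0}"
      unfolding f_def using q_power_nome[of 4] nz by (intro holomorphic_intros qTheta_holomorphic) auto
    show "(\<lambda>z. qTheta z (q\<^sup>2)) holomorphic_on - {0}"
      using q_power_nome[of 2] by (intro holomorphic_intros qTheta_holomorphic) auto
    show "f z = 0 \<and> deriv (\<lambda>z. qTheta z (q^2)) z \<noteq> 0" if z: "z \<noteq> 0" "qTheta z (q^2) = 0" for z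
    proof
      obtain n where n: "z = (q^2) powi n * 1"
        using qTheta_eq_0_iff[OF q_power_nome, of 2 z] z by auto
      show "f z = 0"
        unfolding n using quasi_periodic_zero_shift[OF q_power_nome(2)[of 2], of f "\<lambda>z. - 1 / z" 1 n, OF fper] f1 by simp
    qed (rule qTheta_deriv_nonzero[OF q_power_nome z], simp)
  qed (use fper Pper in auto)
  have E: "qpoch_inf (q^2) (q^2) \<noteq> 0" "qpoch_inf (q^4) (q^4) \<noteq> 0" by (simp_all add: qpoch_inf_q_power_nonzero)
  have m1: "qTheta (-1) (q^2) * qpoch_inf (q^2) (q^2) = 2 * (qpoch_inf (q^4) (q^4))\<^sup>2"
    using qTheta_minus_one[OF q_power_nome(1), of 2] by (simp flip: power_mult)
  then have "qTheta (-1) (q^2) \<noteq> 0" using E by auto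
  have "(qTheta (- q) (q^4))\<^sup>2 * qpoch_inf (q^2) (q^2) = qTheta (- q) (q^2) * (qpoch_inf (q^4) (q^4))\<^sup>2"
  proof -
    have "(q^2)^2 = q^4" "q^2 * (- q) = q^3 * (-1)" "q * (-1) = - q"
      by (simp_all add: power_numeral_reduce)
    then show ?thesis
      using qTheta_split[OF q_power_nome, of 2 "-q"] refl[of "-1"]
      by (simp add: power2_eq_square[of "qTheta a b" for a b])
  qed
  moreover have "f (-1) = 2 * (qTheta (- q) (q^4))\<^sup>2"
    using refl[of "-1"] by (simp add: f_def)
  ultimately have "f (-1) * qpoch_inf (q^2) (q^2) = qTheta (- q) (q^2) * (qTheta (-1) (q^2) * qpoch_inf (q^2) (q^2))"
    unfolding m1 by simp
  then have "c = qTheta (- q) (q^2)"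
    using c[of "-1"] E \<open>qTheta (-1) (q^2) \<noteq> 0\<close> by simp
  then show ?thesis using c[OF x] by (simp add: f_def)
qed

text \<open>
  Up to denominators, this is the vanishing of the four-term sum at an eighth root of unity \<open>z\<close>. By
  \<open>qTheta_square_difference\<close> the factor \<open>b\<^sup>2 - z d\<^sup>2\<close> is a product. The first factor on the right is
  brought into the same shape: as \<open>1 / z\<^sup>2 = - z\<^sup>2\<close>, its coefficients \<open>\<Theta>(-q\<^sup>8; q\<^sup>1\<^sup>6)\<close> and \<open>\<Theta>(-1; q\<^sup>1\<^sup>6)\<close> are,
  up to monomials and factors \<open>(q\<^sup>n; q\<^sup>n)\<close>, the squares of \<open>\<Theta>(q\<^sup>4 z\<^sup>2; q\<^sup>8)\<close> and \<open>\<Theta>(z\<^sup>2; q\<^sup>8)\<close>. By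
  duplication \<open>c\<close> divides the former and \<open>a\<close> the latter, the cofactors being their values at \<open>-z\<close>.
  Then \<open>a\<^sup>2 c\<^sup>2\<close> can be taken out, and a difference of squares at \<open>-z\<close> remains.
\<close>
lemma theta_relation_fourth_root_minus_one:
  assumes z: "z ^ 4 = -1"
  defines "a \<equiv> qTheta z (q^4)" and "b \<equiv> qTheta (q * z) (q^4)"
    and "c \<equiv> qTheta (q^2 * z) (q^4)" and "d \<equiv> qTheta (q^3 * z) (q^4)"
  shows "qTheta (- (q^4)) (q^16) * (b\<^sup>2 - z * d\<^sup>2) * (a * c)
       = (qTheta (- (q^8)) (q^16) * a\<^sup>2 - q * z * qTheta (-1) (q^16) * c\<^sup>2) * (b * d)"
proof -
  define a' c' where "a' = qTheta (- z) (q^4)" and "c' = qTheta (- (q^2 * z)) (q^4)"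
  define A B D where "A = qTheta (- (q^8)) (q^16)" and "B = qTheta (-1) (q^16)" and "D = qTheta (- (q^4)) (q^16)"
  define \<Phi> where "\<Phi> = qTheta (- q) (q^2)"
  define e2 e4 e8 e16 where "e2 = qpoch_inf (q^2) (q^2)" and "e4 = qpoch_inf (q^4) (q^4)"
    and "e8 = qpoch_inf (q^8) (q^8)" and "e16 = qpoch_inf (q^16) (q^16)"
  note e_defs = e2_def e4_def e8_def e16_def
  have E: "e2 \<noteq> 0" "e4 \<noteq> 0" "e8 \<noteq> 0" "e16 \<noteq> 0" by (simp_all add: qpoch_inf_q_power_nonzero e_defs)
  have nz: "q \<noteq> 0" "z \<noteq> 0" using q_nonzero z by auto
  have z2: "1 / z^2 = - (z^2)" using z nz by (simp add: field_simps power_numeral_reduce)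
  have bd: "b\<^sup>2 - z * d\<^sup>2 = qTheta z (q^2) * \<Phi>"
    using qTheta_square_difference[OF nz(2)] by (simp add: b_def d_def \<Phi>_def)
  have ac: "a * c * e2 = qTheta z (q^2) * e4\<^sup>2"
    using qTheta_split[OF q_power_nome, of 2 z] by (simp add: a_def c_def e_defs flip: power_mult)
  have bd2: "b * d * e2 = qTheta (q * z) (q^2) * e4\<^sup>2"
  proof -
    have "q^2 * (q * z) = q^3 * z" by (simp add: power_numeral_reduce)
    note 1 = qTheta_split[OF q_power_nome, of 2 "q * z", unfolded this]
    show ?thesis
      using 1 by (simp add: b_def d_def e_defs flip: power_mult)
  qed
  have AA: "A * e4^4 = c\<^sup>2 * c'\<^sup>2 * e16"
  proof -
    define t where "t = qTheta (q^4 * z^2) (q^8)"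
    have "q^8 / (q^4 * z^2) = q^4 * (1 / z^2)"
      using nz by (simp add: field_simps flip: power_add)
    also have "\<dots> = - (q^4 * z^2)" by (simp add: z2)
    finally have "qTheta (- (q^4 * z^2)) (q^8) = t"
      using qTheta_reflect[OF q_power_nome(2), of 8 "q^4 * z^2"] by (simp add: t_def)
    moreover have "(q^4 * z^2)^2 = - (q^8)" using z by (simp add: power_mult_distrib flip: power_mult)
    ultimately have 1: "t * t * e16 = A * e8\<^sup>2"
      using qTheta_mult_minus[OF q_power_nome(1), of 8 "q^4 * z^2"] by (simp add: t_def A_def e_defs flip: power_mult)
    have 2: "c * c' * e8 = t * e4\<^sup>2"
      using qTheta_mult_minus[OF q_power_nome(1), of 4 "q^2 * z"]
      by (simp add: t_def c_def c'_def e_defs power_mult_distrib flip: power_mult)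
    have "A * e4^4 * e8\<^sup>2 = (t * e4\<^sup>2)\<^sup>2 * e16"
      using 1 by algebra
    also have "\<dots> = c\<^sup>2 * c'\<^sup>2 * e16 * e8\<^sup>2"
      unfolding 2[symmetric] by algebra
    finally show ?thesis using E by simp
  qed
  have BB: "B * e4^4 = z^2 * a\<^sup>2 * a'\<^sup>2 * e16"
  proof -
    define t where "t = qTheta (z^2) (q^8)"
    have "qTheta (- (z^2)) (q^8) = - t / z^2"
      using qTheta_inverse[OF q_power_nome, of 8 "z^2"] nz by (simp add: t_def z2)
    also have "\<dots> = - t * (1 / z^2)" by simp
    also have "\<dots> = z^2 * t" unfolding z2 by simp
    finally have "qTheta (- (z^2)) (q^8) = z^2 * t" .
    moreover have "(z^2)^2 = -1" using z by (simp flip: power_mult)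
    ultimately have 1: "t * (z^2 * t) * e16 = B * e8\<^sup>2"
      using qTheta_mult_minus[OF q_power_nome(1), of 8 "z^2"] by (simp add: t_def B_def e_defs flip: power_mult)
    have 2: "a * a' * e8 = t * e4\<^sup>2"
      using qTheta_mult_minus[OF q_power_nome(1), of 4 z]
      by (simp add: t_def a_def a'_def e_defs power_mult_distrib flip: power_mult)
    have "B * e4^4 * e8\<^sup>2 = z^2 * (t * e4\<^sup>2)\<^sup>2 * e16"
      using 1 by algebra
    also have "\<dots> = z^2 * a\<^sup>2 * a'\<^sup>2 * e16 * e8\<^sup>2"
      unfolding 2[symmetric] by algebra
    finally show ?thesis using E by simp
  qed
  have diff: "c'\<^sup>2 - q * z^3 * a'\<^sup>2 = qTheta (- (q * z)) (q^2) * \<Phi>"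
  proof -
    have 1: "q * (- (q * z)) = - (q^2 * z)" "q^3 * (- (q * z)) = q^4 * (- z)"
      by (simp_all add: power_numeral_reduce)
    have 2: "qTheta (q^4 * (- z)) (q^4) = a' / z"
      using qTheta_shift[OF q_power_nome, of 4 "- z"] nz by (simp add: a'_def)
    have "q * z * (1 / z)^2 = - (q * z^3)"
      using z nz by (simp add: field_simps power_numeral_reduce)
    moreover have "q * z * (a' / z)\<^sup>2 = q * z * (1 / z)^2 * a'\<^sup>2"
      by (simp add: power_divide)
    ultimately have "q * z * (a' / z)\<^sup>2 = - (q * z^3 * a'\<^sup>2)"
      by simp
    then show ?thesis
      using qTheta_square_difference[of "- (q * z)"] nz
      unfolding 1 2 by (simp add: c'_def \<Phi>_def)
  qed
  \<comment> \<open>The two theta values of base \<open>q\<^sup>2\<close> that are left combine to the constant \<open>D\<close>.\<close>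
  have prod: "qTheta (q * z) (q^2) * qTheta (- (q * z)) (q^2) * e16 = D * e2\<^sup>2"
  proof -
    have sq: "(q^2 * z^2)^2 = - (q^4)" using z by (simp add: power_mult_distrib flip: power_mult)
    have inv: "q^4 / (q^2 * z^2) = - (q^2 * z^2)"
    proof -
      have "q^4 / (q^2 * z^2) = q^2 * (1 / z^2)"
        using nz by (simp add: field_simps flip: power_add)
      then show ?thesis by (simp add: z2)
    qed
    have 1: "qTheta (q * z) (q^2) * qTheta (- (q * z)) (q^2) * e4 = qTheta (q^2 * z^2) (q^4) * e2\<^sup>2"
      using qTheta_mult_minus[OF q_power_nome(1), of 2 "q * z"]
      by (simp add: e_defs power_mult_distrib flip: power_mult)
    have 2: "qTheta (q^2 * z^2) (q^4) = qpoch_inf (- (q^4)) (q^8) * e4"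
      using qpoch_inf_mult_minus[OF q_power_nome(1), of 4 "q^2 * z^2"]
      unfolding qTheta_def inv sq by (simp add: e_defs flip: power_mult)
    have "q^16 / q^4 = q^12" using nz by (simp add: field_simps flip: power_add)
    then have 3: "D = qpoch_inf (- (q^4)) (q^8) * e16"
      using qpoch_inf_split[OF q_power_nome(1), of 8 "- (q^4)"] nz
      by (simp add: D_def qTheta_def e_defs flip: power_mult power_add)
    have "qTheta (q * z) (q^2) * qTheta (- (q * z)) (q^2) * e16 * e4 = D * e2\<^sup>2 * e4"
      using 1 unfolding 2 3 by algebra
    then show ?thesis using E by simp
  qed
  have "(A * a\<^sup>2 - q * z * B * c\<^sup>2) * e4^4 = a\<^sup>2 * c\<^sup>2 * e16 * (c'\<^sup>2 - q * z^3 * a'\<^sup>2)"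
    using AA BB by algebra
  then have "(A * a\<^sup>2 - q * z * B * c\<^sup>2) * e4^4 * (b * d * e2) = a\<^sup>2 * c\<^sup>2 * \<Phi> * D * e2\<^sup>2 * e4\<^sup>2"
    unfolding diff bd2 using prod by algebra
  also have "\<dots> = D * (qTheta z (q^2) * e4\<^sup>2) * \<Phi> * (a * c) * e2 * e4\<^sup>2"
    unfolding ac[symmetric] by algebra
  also have "\<dots> = D * (b\<^sup>2 - z * d\<^sup>2) * (a * c) * e2 * e4^4"
    unfolding bd by algebra
  finally show ?thesis using E unfolding A_def[symmetric] B_def[symmetric] D_def[symmetric] by simp
qed

section \<open>Symmetries and holomorphy of the sum\<close>

text \<open>
  The summands are permuted cyclically: \<open>z \<mapsto> q z\<close> turns the numerators and the denominator of each
  summand into those of the next one, up to a monomial which is the same for all four.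
\<close>
lemma theta_sum_shift:
  assumes z: "z \<noteq> 0"
  shows "theta_sum q (q * z) = - 1 / (q^3 * z^11) * theta_sum q z"
proof -
  have 0: "summand0 q (q * z) = - 1 / (q^3 * z^11) * summand1 q z"
  proof -
    have 1: "qTheta (- (q^2) * (q * z)^3) (q^4) = - qTheta (- q * z^3) (q^4) / (- q * z^3)"
      by (rule qTheta_shiftI) (use q_nonzero z in \<open>auto simp: power_mult_distrib power_numeral_reduce\<close>)
    have 2: "(q * z)^12 = q^12 * z^12" by (rule power_mult_distrib)
    \<comment> \<open>With the theta values as indeterminates, an identity of monomials is left, valid also for \<open>W = 0\<close>.\<close>
    have "- q * (1 / (q * z)^3) * (- X / (- q * z^3) * Y / W) = - 1 / (q^3 * z^11) * (z^5 * (X * Y / W))" for X Y W :: complex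
      using q_nonzero z by (simp add: divide_simps power_mult_distrib power_numeral_reduce)
    then show ?thesis
      unfolding summand_defs power_int_minus3 1 2 .
  qed
  have 1: "summand1 q (q * z) = - 1 / (q^3 * z^11) * summand2 q z"
  proof -
    have 1: "qTheta (- q * (q * z)^3) (q^4) = - qTheta (- (z^3)) (q^4) / (- (z^3))"
      by (rule qTheta_shiftI) (use q_nonzero z in \<open>auto simp: power_mult_distrib power_numeral_reduce\<close>)
    have 2: "qTheta (q^12 * (q * z)^12) (q^16) = - qTheta (q^8 * z^12) (q^16) / (q^8 * z^12)"
      by (rule qTheta_shiftI) (use q_nonzero z in \<open>auto simp: power_mult_distrib power_numeral_reduce\<close>)
    have 3: "q * (q * z) = q^2 * z" by (simp add: power_numeral_reduce)
    have "(q * z)^5 * (- X / (- (z^3)) * (- Y / (q^8 * z^12)) / W) = - 1 / (q^3 * z^11) * (z * (X * Y / W))" for X Y W :: complex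
      using q_nonzero z by (simp add: divide_simps power_mult_distrib power_numeral_reduce)
    then show ?thesis
      unfolding summand_defs power_int_minus3 1 2 3 .
  qed
  have 2: "summand2 q (q * z) = - 1 / (q^3 * z^11) * summand3 q z"
  proof -
    have 1: "- ((q * z)^3) = - (q^3) * z^3" by (simp add: power_mult_distrib)
    have 2: "qTheta (q^8 * (q * z)^12) (q^16) = - qTheta (q^4 * z^12) (q^16) / (q^4 * z^12)"
      by (rule qTheta_shiftI) (use q_nonzero z in \<open>auto simp: power_mult_distrib power_numeral_reduce\<close>)
    have 3: "q^2 * (q * z) = q^3 * z" by (simp add: power_numeral_reduce)
    have "q * z * (X * (- Y / (q^4 * z^12)) / W) = - 1 / (q^3 * z^11) * (X * Y / W)" for X Y W :: complex
      using q_nonzero z by (simp add: divide_simps power_mult_distrib power_numeral_reduce)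
    then show ?thesis
      unfolding summand_defs power_int_minus3 1 2 3 .
  qed
  have 3: "summand3 q (q * z) = - 1 / (q^3 * z^11) * summand0 q z"
  proof -
    have 1: "qTheta (- (q^3) * (q * z)^3) (q^4) = - qTheta (- (q^2) * z^3) (q^4) / (- (q^2) * z^3)"
      by (rule qTheta_shiftI) (use q_nonzero z in \<open>auto simp: power_mult_distrib power_numeral_reduce\<close>)
    have 2: "qTheta (q^4 * (q * z)^12) (q^16) = - qTheta (z^12) (q^16) / (z^12)"
      by (rule qTheta_shiftI) (use q_nonzero z in \<open>auto simp: power_mult_distrib power_numeral_reduce\<close>)
    have 3: "qTheta (q^3 * (q * z)) (q^4) = - qTheta z (q^4) / z"
      by (rule qTheta_shiftI) (use q_nonzero z in \<open>auto simp: power_mult_distrib power_numeral_reduce\<close>)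
    have "(- X / (- (q^2) * z^3)) * (- Y / z^12) / (- W / z) = - 1 / (q^3 * z^11) * (- q * (1 / z^3) * (X * Y / W))" for X Y W :: complex
      using q_nonzero z by (simp add: divide_simps power_mult_distrib power_numeral_reduce)
    then show ?thesis
      unfolding summand_defs power_int_minus3 1 2 3 .
  qed
  show ?thesis
    unfolding theta_sum_def 0 1 2 3 by (simp only: distrib_left add_ac)
qed

text \<open>
  The first and the third summand are each fixed up to the factor \<open>z\<^sup>-\<^sup>5\<close>, while the second and the
  fourth are exchanged.
\<close>
lemma theta_sum_inverse:
  assumes z: "z \<noteq> 0"
  shows "theta_sum q (1 / z) = theta_sum q z / z^5"
proof -
  have 0: "summand0 q (1 / z) = summand0 q z / z^5"
  proof -
    have 1: "qTheta (- (q^2) * (1 / z)^3) (q^4) = qTheta (- (q^2) * z^3) (q^4)"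
      by (rule qTheta_reflectI) (use q_nonzero z in \<open>auto simp: field_simps power_numeral_reduce\<close>)
    have 2: "qTheta ((1 / z)^12) (q^16) = - qTheta (z^12) (q^16) / z^12"
      by (rule qTheta_inverseI) (use q_nonzero z in \<open>auto simp: power_divide\<close>)
    have 3: "qTheta (1 / z) (q^4) = - qTheta z (q^4) / z"
      by (rule qTheta_inverseI) (use q_nonzero z in auto)
    have "- q * (1 / (1 / z)^3) * (X * (- Y / z^12) / (- W / z)) = - q * (1 / z^3) * (X * Y / W) / z^5" for X Y W :: complex
      using q_nonzero z by (simp add: divide_simps power_divide power_numeral_reduce)
    then show ?thesis
      unfolding summand_defs power_int_minus3 1 2 3 .
  qed
  have 1: "summand1 q (1 / z) = summand3 q z / z^5"
  proof -
    have 1: "qTheta (- q * (1 / z)^3) (q^4) = qTheta (- (q^3) * z^3) (q^4)"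
      by (rule qTheta_reflectI) (use q_nonzero z in \<open>auto simp: field_simps power_numeral_reduce\<close>)
    have 2: "qTheta (q^12 * (1 / z)^12) (q^16) = qTheta (q^4 * z^12) (q^16)"
      by (rule qTheta_reflectI) (use q_nonzero z in \<open>auto simp: field_simps power_numeral_reduce\<close>)
    have 3: "qTheta (q * (1 / z)) (q^4) = qTheta (q^3 * z) (q^4)"
      by (rule qTheta_reflectI) (use q_nonzero z in \<open>auto simp: field_simps power_numeral_reduce\<close>)
    have "(1 / z)^5 * (X * Y / W) = X * Y / W / z^5" for X Y W :: complex
      using q_nonzero z by (simp add: divide_simps power_divide power_numeral_reduce)
    then show ?thesis
      unfolding summand_defs power_int_minus3 1 2 3 .
  qed
  have 2: "summand2 q (1 / z) = summand2 q z / z^5"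
  proof -
    have 1: "qTheta (- ((1 / z)^3)) (q^4) = - qTheta (- (z^3)) (q^4) / (- (z^3))"
      by (rule qTheta_inverseI) (use q_nonzero z in \<open>auto simp: power_divide\<close>)
    have 2: "qTheta (q^8 * (1 / z)^12) (q^16) = qTheta (q^8 * z^12) (q^16)"
      by (rule qTheta_reflectI) (use q_nonzero z in \<open>auto simp: field_simps power_numeral_reduce\<close>)
    have 3: "qTheta (q^2 * (1 / z)) (q^4) = qTheta (q^2 * z) (q^4)"
      by (rule qTheta_reflectI) (use q_nonzero z in \<open>auto simp: field_simps power_numeral_reduce\<close>)
    have "1 / z * (- X / (- (z^3)) * Y / W) = z * (X * Y / W) / z^5" for X Y W :: complex
      using q_nonzero z by (simp add: divide_simps power_divide power_numeral_reduce)
    then show ?thesis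
      unfolding summand_defs power_int_minus3 1 2 3 .
  qed
  have 3: "summand3 q (1 / z) = summand1 q z / z^5"
  proof -
    have 1: "qTheta (- (q^3) * (1 / z)^3) (q^4) = qTheta (- q * z^3) (q^4)"
      by (rule qTheta_reflectI) (use q_nonzero z in \<open>auto simp: field_simps power_numeral_reduce\<close>)
    have 2: "qTheta (q^4 * (1 / z)^12) (q^16) = qTheta (q^12 * z^12) (q^16)"
      by (rule qTheta_reflectI) (use q_nonzero z in \<open>auto simp: field_simps power_numeral_reduce\<close>)
    have 3: "qTheta (q^3 * (1 / z)) (q^4) = qTheta (q * z) (q^4)"
      by (rule qTheta_reflectI) (use q_nonzero z in \<open>auto simp: field_simps power_numeral_reduce\<close>)
    have "X * Y / W = z^5 * (X * Y / W) / z^5" for X Y W :: complex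
      using q_nonzero z by (simp add: divide_simps power_divide power_numeral_reduce)
    then show ?thesis
      unfolding summand_defs power_int_minus3 1 2 3 .
  qed
  show ?thesis
    unfolding theta_sum_def 0 1 2 3 by (simp add: add_divide_distrib)
qed

lemma theta_den_shift:
  assumes z: "z \<noteq> 0"
  shows "theta_den q (q * z) = - 1 / z * theta_den q z"
proof -
  have 1: "qTheta (q^3 * (q * z)) (q^4) = - qTheta z (q^4) / z"
    by (rule qTheta_shiftI) (use q_nonzero z in \<open>auto simp: power_numeral_reduce\<close>)
  have 2: "q * (q * z) = q^2 * z" "q^2 * (q * z) = q^3 * z" by (simp_all add: power_numeral_reduce)
  show ?thesis unfolding theta_den_def 1 2 by simp
qed

text \<open>
  If \<open>y\<close> is a power of \<open>q\<^sup>4\<close>, then \<open>y\<^sup>1\<^sup>2\<close> is a power of \<open>q\<^sup>4\<^sup>8\<close>, hence of \<open>q\<^sup>1\<^sup>6\<close>. So the second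
  numerator of each summand vanishes at all zeros of its denominator.
\<close>
lemma qTheta_zero_power12:
  assumes "y \<noteq> 0" "qTheta y (q^4) = 0"
  shows "qTheta (y^12) (q^16) = 0"
proof -
  obtain n where n: "y = (q^4) powi n"
    using qTheta_eq_0_iff[OF q_power_nome, of 4 y] assms by auto
  have "y^12 = (q^4) powi (n * 12)"
    unfolding n by (simp add: power_int_mult)
  also have "\<dots> = (q^4) powi (4 * (3 * n))" by (simp add: mult.commute)
  also have "\<dots> = (q^16) powi (3 * n)"
    by (subst power_int_mult) (simp flip: power_mult)
  finally have ex: "\<exists>m. y^12 = (q^16) powi m" by blast
  then show ?thesis
    by (subst qTheta_eq_0_iff[OF q_power_nome]) (use assms(1) in simp_all)
qed

text \<open>
  Multiplied out, this is a sum of products of theta functions. The two expressions agree even where a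
  denominator vanishes: the only term in which this factor has been cancelled then contains a
  vanishing numerator.
\<close>
lemma theta_sum_den_holomorphic: "(\<lambda>z. theta_sum q z * theta_den q z) holomorphic_on - {0}"
proof -
  define t0 t1 t2 t3 where "t0 = (\<lambda>z. qTheta z (q^4))" and "t1 = (\<lambda>z. qTheta (q * z) (q^4))"
    and "t2 = (\<lambda>z. qTheta (q^2 * z) (q^4))" and "t3 = (\<lambda>z. qTheta (q^3 * z) (q^4))"
  define A0 A1 A2 A3 where
    "A0 = (\<lambda>z. - q * (1 / z^3) * (qTheta (- (q ^ 2) * z ^ 3) (q ^ 4) * qTheta (z ^ 12) (q ^ 16)))" and
    "A1 = (\<lambda>z. z^5 * (qTheta (- q * z ^ 3) (q ^ 4) * qTheta (q ^ 12 * z ^ 12) (q ^ 16)))" and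
    "A2 = (\<lambda>z. z * (qTheta (- (z ^ 3)) (q ^ 4) * qTheta (q ^ 8 * z ^ 12) (q ^ 16)))" and
    "A3 = (\<lambda>z. qTheta (- (q ^ 3) * z ^ 3) (q ^ 4) * qTheta (q ^ 4 * z ^ 12) (q ^ 16))"
  note defs = t0_def t1_def t2_def t3_def A0_def A1_def A2_def A3_def
  define h where "h = (\<lambda>z. A0 z * (t1 z * t2 z * t3 z) + A1 z * (t0 z * t2 z * t3 z)
    + A2 z * (t0 z * t1 z * t3 z) + A3 z * (t0 z * t1 z * t2 z))"
  have "h holomorphic_on - {0}"
    unfolding h_def defs using q_power_nome[of 4] q_power_nome[of 16] q_nonzero
    by (intro holomorphic_intros qTheta_holomorphic) auto
  moreover have "h z = theta_sum q z * theta_den q z" if "z \<in> - {0}" for z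
  proof -
    have z: "z \<noteq> 0" using that by simp
    have "A0 z = 0" if "t0 z = 0"
      using qTheta_zero_power12[of z] z that by (simp add: defs)
    then have 0: "A0 z = summand0 q z * t0 z"
      unfolding summand0_def power_int_minus3 by (cases "t0 z = 0") (auto simp: defs)
    have "A1 z = 0" if "t1 z = 0"
      using qTheta_zero_power12[of "q * z"] z q_nonzero that by (simp add: defs power_mult_distrib)
    then have 1: "A1 z = summand1 q z * t1 z"
      unfolding summand1_def by (cases "t1 z = 0") (auto simp: defs)
    have "A2 z = 0" if "t2 z = 0"
    proof -
      have "qTheta ((q^2 * z)^12) (q^16) = - qTheta (q^8 * z^12) (q^16) / (q^8 * z^12)"
        by (rule qTheta_shiftI) (use q_nonzero z in \<open>auto simp: power_mult_distrib simp flip: power_mult power_add mult.assoc\<close>)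
      then show ?thesis
        using qTheta_zero_power12[of "q^2 * z"] z q_nonzero that by (simp add: defs)
    qed
    then have 2: "A2 z = summand2 q z * t2 z"
      unfolding summand2_def by (cases "t2 z = 0") (auto simp: defs)
    have "A3 z = 0" if "t3 z = 0"
    proof -
      have "qTheta ((q^3 * z)^12) (q^16) = - qTheta (q^20 * z^12) (q^16) / (q^20 * z^12)"
        by (rule qTheta_shiftI) (use q_nonzero z in \<open>auto simp: power_mult_distrib simp flip: power_mult power_add mult.assoc\<close>)
      moreover have "qTheta (q^20 * z^12) (q^16) = - qTheta (q^4 * z^12) (q^16) / (q^4 * z^12)"
        by (rule qTheta_shiftI) (use q_nonzero z in \<open>auto simp: power_mult_distrib simp flip: power_mult power_add mult.assoc\<close>)
      ultimately show ?thesis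
        using qTheta_zero_power12[of "q^3 * z"] z q_nonzero that by (simp add: defs)
    qed
    then have 3: "A3 z = summand3 q z * t3 z"
      unfolding summand3_def by (cases "t3 z = 0") (auto simp: defs)
    show ?thesis
      unfolding h_def 0 1 2 3 theta_sum_def theta_den_def t0_def[symmetric]
      by (simp add: t0_def t1_def t2_def t3_def algebra_simps)
  qed
  ultimately show ?thesis by (rule holomorphic_transform)
qed

lemma theta_sum_den_shift:
  assumes "z \<noteq> 0"
  shows "theta_sum q (q * z) * theta_den q (q * z) = 1 / (q^3 * z^12) * (theta_sum q z * theta_den q z)"
  unfolding theta_sum_shift[OF assms] theta_den_shift[OF assms]
  using assms by (simp add: power_numeral_reduce)

section \<open>The zeros of the product\<close>

lemma theta_prod_shift:
  assumes z: "z \<noteq> 0"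
  shows "theta_prod q (q * z) = 1 / (q^3 * z^12) * theta_prod q z"
proof -
  have 1: "qTheta (- ((q * z)^4)) (q^2) = - qTheta (- (q^2 * z^4)) (q^2) / (- (q^2 * z^4))"
    by (rule qTheta_shiftI) (use q_nonzero z in \<open>auto simp: power_mult_distrib simp flip: power_add mult.assoc\<close>)
  have 2: "qTheta (- (q^2 * z^4)) (q^2) = - qTheta (- (z^4)) (q^2) / (- (z^4))"
    by (rule qTheta_shiftI) (use z in auto)
  have 3: "qTheta ((q * z)^2) q = - qTheta (q * z^2) q / (q * z^2)"
    using qTheta_shift[OF q(2) q_nonzero, of "q * z^2"] q_nonzero z by (simp add: power_mult_distrib power2_eq_square mult_ac)
  have 4: "qTheta (q * z^2) q = - qTheta (z^2) q / z^2"
    using qTheta_shift[OF q(2) q_nonzero, of "z^2"] z by simp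
  show ?thesis
    unfolding theta_prod_def 1 2 3 4 using q_nonzero z
    by (simp add: field_simps power_numeral_reduce)
qed

lemma qTheta_quartic_zeros:
  assumes "z \<noteq> 0" "qTheta (- (z ^ 4)) (q ^ 2) = 0"
  obtains n :: int where "z^4 = - (q powi (2 * n))"
proof -
  obtain n where "- (z^4) = (q^2) powi n"
    using qTheta_eq_0_iff[OF q_power_nome, of 2 "- (z^4)"] assms by auto
  then have "z^4 = - ((q^2) powi n)" by (metis minus_minus)
  then have "z^4 = - (q powi (2 * n))"
    by (simp add: power_int_mult)
  then show ?thesis by (rule that)
qed

lemma qTheta_square_zeros:
  assumes "z \<noteq> 0" "qTheta (z ^ 2) q = 0"
  obtains n :: int where "z^2 = q powi n"
  using qTheta_eq_0_iff[OF q(2) q_nonzero, of "z^2"] assms by auto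

lemma theta_prod_holomorphic: "theta_prod q holomorphic_on - {0}"
proof -
  have "(\<lambda>z. theta_prod q z) holomorphic_on - {0}"
    unfolding theta_prod_def using q_power_nome[of 2] q_nonzero q(2)
    by (intro holomorphic_intros qTheta_holomorphic) auto
  then show ?thesis by simp
qed

text \<open>
  Each factor is a theta function composed with a monomial, whose derivative is nonzero away from 0. The
  factors have no common zero: otherwise \<open>q\<^sup>2\<^sup>m = - q\<^sup>2\<^sup>n\<close>, and comparing norms gives \<open>m = n\<close>.
\<close>
lemma theta_prod_simple_zeros:
  assumes z: "z \<noteq> 0" and P: "theta_prod q z = 0"
  shows "deriv (theta_prod q) z \<noteq> 0"
proof -
  define f g where "f = (\<lambda>z. qTheta (- (z ^ 4)) (q ^ 2))" and "g = (\<lambda>z. qTheta (z ^ 2) q)"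
  have fg: "theta_prod q = (\<lambda>z. f z * g z)" by (auto simp: theta_prod_def f_def g_def fun_eq_iff)
  have hol: "f holomorphic_on - {0}" "g holomorphic_on - {0}"
    unfolding f_def g_def using q_power_nome[of 2] q_nonzero q(2)
    by (intro holomorphic_intros qTheta_holomorphic; auto)+
  have df: "(f has_field_derivative deriv f z) (at z)" and dg: "(g has_field_derivative deriv g z) (at z)"
    using holomorphic_derivI[OF hol(1), of z] holomorphic_derivI[OF hol(2), of z] z by (auto simp: open_Compl)
  have d: "deriv (theta_prod q) z = f z * deriv g z + deriv f z * g z"
    unfolding fg by (rule DERIV_imp_deriv[OF DERIV_mult'[OF df dg]])
  have f': "deriv f z \<noteq> 0" if zero: "f z = 0"
  proof -
    obtain D where D: "((\<lambda>x. qTheta x (q^2)) has_field_derivative D) (at (- (z^4)))" "D \<noteq> 0"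
      using qTheta_simple_zero[OF q_power_nome[of 2], of "- (z^4)"] z zero[unfolded f_def] by auto
    have "((\<lambda>z. - (z^4)) has_field_derivative - (4 * z^3)) (at z)"
      by (auto intro!: derivative_eq_intros)
    from DERIV_chain2[OF D(1) this] have "deriv f z = D * - (4 * z^3)"
      unfolding f_def by (rule DERIV_imp_deriv)
    then show ?thesis using D z by simp
  qed
  have g': "deriv g z \<noteq> 0" if zero: "g z = 0"
  proof -
    obtain D where D: "((\<lambda>x. qTheta x q) has_field_derivative D) (at (z^2))" "D \<noteq> 0"
      using qTheta_simple_zero[OF q(2) q_nonzero, of "z^2"] z zero[unfolded g_def] by auto
    have "((\<lambda>z. z^2) has_field_derivative 2 * z) (at z)"
      by (auto intro!: derivative_eq_intros)
    from DERIV_chain2[OF D(1) this] have "deriv g z = D * (2 * z)"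
      unfolding g_def by (rule DERIV_imp_deriv)
    then show ?thesis using D z by simp
  qed
  have "\<not> (f z = 0 \<and> g z = 0)"
  proof
    assume "f z = 0 \<and> g z = 0"
    then obtain n m where n: "z^4 = - (q powi (2 * n))" and m: "z^2 = q powi m"
      using qTheta_quartic_zeros[OF z] qTheta_square_zeros[OF z] unfolding f_def g_def by metis
    have "z^4 = (z^2)^2" by (simp flip: power_mult)
    also have "\<dots> = q powi (2 * m)" unfolding m by (simp add: mult.commute power_int_mult)
    finally have eq: "q powi (2 * m) = - (q powi (2 * n))" using n by simp
    then have "norm (q powi (2 * m)) = norm (q powi (2 * n))" by simp
    then have "norm q powi (2 * m) = norm q powi (2 * n)" by (simp add: norm_power_int)
    then have "2 * m = 2 * n"
      using q power_int_strict_decreasing[of "2*m" "2*n" "norm q"] power_int_strict_decreasing[of "2*n" "2*m" "norm q"]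
      by (metis less_irrefl linorder_neqE)
    then have "q powi (2 * n) = - (q powi (2 * n))" using eq by simp
    then show False using q_nonzero by (simp add: eq_neg_iff_add_eq_0)
  qed
  moreover have "f z = 0 \<or> g z = 0" using P by (simp add: fg)
  ultimately show ?thesis unfolding d using f' g' by auto
qed

lemma theta_den_eq:
  "theta_den q z * qpoch_inf q q = qTheta z q * qpoch_inf (q^4) (q^4) ^ 4"
proof -
  define e1 e2 e4 where "e1 = qpoch_inf q q" and "e2 = qpoch_inf (q^2) (q^2)" and "e4 = qpoch_inf (q^4) (q^4)"
  have E: "e2 \<noteq> 0" using qpoch_inf_q_power_nonzero[of 2] by (simp add: e2_def)
  define a b c d where "a = qTheta z (q^4)" and "b = qTheta (q * z) (q^4)"
    and "c = qTheta (q^2 * z) (q^4)" and "d = qTheta (q^3 * z) (q^4)"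
  have 1: "a * c * e2 = qTheta z (q^2) * e4\<^sup>2"
    using qTheta_split[OF q_power_nome, of 2 z] by (simp add: a_def c_def e2_def e4_def flip: power_mult)
  have "q^2 * (q * z) = q^3 * z" by (simp add: power_numeral_reduce)
  note 2 = qTheta_split[OF q_power_nome, of 2 "q * z", unfolded this]
  have 2: "b * d * e2 = qTheta (q * z) (q^2) * e4\<^sup>2"
    using 2 by (simp add: b_def d_def e2_def e4_def flip: power_mult)
  have 3: "qTheta z (q^2) * qTheta (q * z) (q^2) * e1 = qTheta z q * e2\<^sup>2"
    using qTheta_split[OF q(2) q_nonzero, of z] by (simp add: e1_def e2_def)
  have "a * b * c * d * e1 * e2\<^sup>2 = qTheta z q * e4 ^ 4 * e2\<^sup>2"
    using 1 2 3 by algebra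
  then show ?thesis
    using E unfolding theta_den_def a_def b_def c_def d_def e1_def e4_def by simp
qed

lemma theta_prod_eq:
  "theta_prod q z * (qpoch_inf q q * qpoch_inf (q^2) (q^2))
    = qTheta (- (z^4)) (q^2) * qTheta (q * z^2) (q^2) * qTheta (- z) q * qTheta z q"
proof -
  define e1 e2 where "e1 = qpoch_inf q q" and "e2 = qpoch_inf (q^2) (q^2)"
  have E: "e1 \<noteq> 0" "e2 \<noteq> 0" using qpoch_inf_q_power_nonzero[of 1] qpoch_inf_q_power_nonzero[of 2] by (simp_all add: e1_def e2_def)
  have 1: "qTheta (z^2) (q^2) * qTheta (q * z^2) (q^2) * e1 = qTheta (z^2) q * e2\<^sup>2"
    using qTheta_split[OF q(2) q_nonzero, of "z^2"] by (simp add: e1_def e2_def)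
  have 2: "qTheta z q * qTheta (- z) q * e2 = qTheta (z^2) (q^2) * e1\<^sup>2"
    using qTheta_mult_minus[OF q(2), of z] by (simp add: e1_def e2_def)
  have "qTheta (z^2) q * (e1 * e2) * (e1 * e2) = qTheta (q * z^2) (q^2) * qTheta (- z) q * qTheta z q * (e1 * e2)"
    using 1 2 by algebra
  then have "qTheta (z^2) q * (e1 * e2) = qTheta (q * z^2) (q^2) * qTheta (- z) q * qTheta z q"
    using E by simp
  then show ?thesis unfolding theta_prod_def e1_def e2_def by simp
qed

section \<open>Vanishing of the sum at these zeros\<close>

text \<open>
  With \<open>z\<^sup>3 = - 1 / z\<close>, every numerator in \<open>z\<^sup>3\<close> becomes, up to a
  monomial, one of the four denominators, but not its own:
  those of the first and third summand are exchanged, as are those of the second and fourth.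
\<close>
lemma theta_sum_zero_fourth_root_minus_one:
  assumes z4: "z^4 = -1" and den: "theta_den q z \<noteq> 0"
  shows "theta_sum q z = 0"
proof -
  define a b c d where "a = qTheta z (q^4)" and "b = qTheta (q * z) (q^4)"
    and "c = qTheta (q^2 * z) (q^4)" and "d = qTheta (q^3 * z) (q^4)"
  note abcd = a_def b_def c_def d_def
  define A B D where "A = qTheta (- (q^8)) (q^16)" and "B = qTheta (-1) (q^16)" and "D = qTheta (- (q^4)) (q^16)"
  have ne: "a \<noteq> 0" "b \<noteq> 0" "c \<noteq> 0" "d \<noteq> 0" "z \<noteq> 0"
    using den z4 by (auto simp: theta_den_def abcd)
  have z3: "z^3 = - (1 / z)" using z4 ne by (simp add: field_simps power_numeral_reduce)
  have z12: "z^12 = -1" using arg_cong[OF z4, of "\<lambda>x. x^3"] by (simp flip: power_mult)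
  have z5: "z^5 = - z" using z4 by (simp add: power_numeral_reduce)
  have s0: "summand0 q z = q * z * (c * B / a)"
  proof -
    have 1: "qTheta (- (q^2) * z^3) (q^4) = c"
      unfolding c_def z3 by (rule qTheta_reflectI) (use q_nonzero ne in \<open>simp add: field_simps power_numeral_reduce\<close>)
    have 2: "1 / z^3 = - z" using z4 ne by (simp add: field_simps power_numeral_reduce)
    show ?thesis
      unfolding summand0_def power_int_minus3 1 2 z12 by (simp add: a_def B_def)
  qed
  have s1: "summand1 q z = - z * (d * D / b)"
  proof -
    have 1: "qTheta (- q * z^3) (q^4) = d"
      unfolding d_def z3 by (rule qTheta_reflectI) (use q_nonzero ne in \<open>simp add: field_simps power_numeral_reduce\<close>)
    have 2: "qTheta (q^12 * (-1)) (q^16) = D"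
      unfolding D_def by (rule qTheta_reflectI) (use q_nonzero in \<open>simp add: field_simps power_numeral_reduce\<close>)
    show ?thesis
      unfolding summand1_def 1 z12 2 z5 by (simp add: b_def)
  qed
  have s2: "summand2 q z = - (a * A / c)"
  proof -
    have 1: "qTheta (- (z^3)) (q^4) = - a / z"
      unfolding a_def z3 by (rule qTheta_inverseI) (use ne in auto)
    show ?thesis
      unfolding summand2_def 1 z12 using ne by (simp add: c_def A_def)
  qed
  have s3: "summand3 q z = b * D / d"
  proof -
    have 1: "qTheta (- (q^3) * z^3) (q^4) = b"
      unfolding b_def z3 by (rule qTheta_reflectI) (use q_nonzero ne in \<open>simp add: field_simps power_numeral_reduce\<close>)
    show ?thesis
      unfolding summand3_def 1 z12 by (simp add: d_def D_def)
  qed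
  have "D * (b\<^sup>2 - z * d\<^sup>2) * (a * c) = (A * a\<^sup>2 - q * z * B * c\<^sup>2) * (b * d)"
    using theta_relation_fourth_root_minus_one[OF z4] unfolding abcd A_def B_def D_def .
  moreover have "theta_sum q z * (a * b * c * d)
      = D * (b\<^sup>2 - z * d\<^sup>2) * (a * c) - (A * a\<^sup>2 - q * z * B * c\<^sup>2) * (b * d)"
    unfolding theta_sum_def s0 s1 s2 s3 using ne by (simp add: field_simps power2_eq_square)
  ultimately show ?thesis using ne by simp
qed

text \<open>
  With \<open>z\<^sup>3 = - q\<^sup>2 / z\<close>, every numerator in \<open>z\<^sup>3\<close> cancels against the denominator of its own summand.
  What remains of the first and fourth summand cancels, as does what remains of the other two.
\<close>
lemma theta_sum_zero_fourth_power_minus_q2: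
  assumes z4: "z^4 = - (q^2)" and den: "theta_den q z \<noteq> 0"
  shows "theta_sum q z = 0"
proof -
  define a b c d where "a = qTheta z (q^4)" and "b = qTheta (q * z) (q^4)"
    and "c = qTheta (q^2 * z) (q^4)" and "d = qTheta (q^3 * z) (q^4)"
  note abcd = a_def b_def c_def d_def
  define G H where "G = qTheta (- (q^2)) (q^16)" and "H = qTheta (- (q^6)) (q^16)"
  have ne: "a \<noteq> 0" "b \<noteq> 0" "c \<noteq> 0" "d \<noteq> 0" "z \<noteq> 0"
    using den z4 q_nonzero by (auto simp: theta_den_def abcd)
  have z3: "z^3 = - (q^2 / z)" using z4 ne by (simp add: field_simps power_numeral_reduce)
  have z12: "z^12 = - (q^6)" using arg_cong[OF z4, of "\<lambda>x. x^3"] by (simp flip: power_mult)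
  have z5: "z^5 = - (q^2) * z" using z4 by (simp add: power_numeral_reduce)
  have s0: "summand0 q z = z / q * H"
  proof -
    have 1: "qTheta (- (q^2) * z^3) (q^4) = a"
      unfolding a_def z3 by (rule qTheta_reflectI) (use q_nonzero ne in \<open>simp add: field_simps power_numeral_reduce\<close>)
    have 2: "1 / z^3 = - (z / q^2)" using z4 ne q_nonzero by (simp add: field_simps power_numeral_reduce)
    show ?thesis
      unfolding summand0_def power_int_minus3 1 2 z12 using ne q_nonzero
      by (simp add: a_def H_def power2_eq_square)
  qed
  have s1: "summand1 q z = - z * G"
  proof -
    have 1: "qTheta (- q * z^3) (q^4) = b"
      unfolding b_def z3 by (rule qTheta_reflectI) (use q_nonzero ne in \<open>simp add: field_simps power_numeral_reduce\<close>)
    have 2: "qTheta (q^12 * (- (q^6))) (q^16) = - G / (- (q^2))"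
      unfolding G_def by (rule qTheta_shiftI) (use q_nonzero in \<open>auto simp flip: power_add\<close>)
    show ?thesis
      unfolding summand1_def 1 z12 2 z5 using ne q_nonzero by (simp add: b_def)
  qed
  have s2: "summand2 q z = z * G"
  proof -
    have 1: "qTheta (- (z^3)) (q^4) = c"
      unfolding c_def z3 by (rule qTheta_reflectI) (use q_nonzero ne in \<open>simp add: field_simps power_numeral_reduce\<close>)
    have 2: "qTheta (q^8 * (- (q^6))) (q^16) = G"
      unfolding G_def by (rule qTheta_reflectI) (use q_nonzero in \<open>simp add: field_simps power_numeral_reduce\<close>)
    show ?thesis
      unfolding summand2_def 1 z12 2 using ne by (simp add: c_def)
  qed
  have s3: "summand3 q z = - (z / q) * H"
  proof -
    have "qTheta (- (q^3) * z^3) (q^4) = - qTheta (q / z) (q^4) / (q / z)"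
      unfolding z3 by (rule qTheta_shiftI) (use q_nonzero ne in \<open>simp_all add: field_simps power_numeral_reduce\<close>)
    moreover have "qTheta (q / z) (q^4) = d"
      unfolding d_def by (rule qTheta_reflectI) (use q_nonzero ne in \<open>simp add: field_simps power_numeral_reduce\<close>)
    ultimately have 1: "qTheta (- (q^3) * z^3) (q^4) = - d / (q / z)" by simp
    have 2: "qTheta (q^4 * (- (q^6))) (q^16) = H"
      unfolding H_def by (rule qTheta_reflectI) (use q_nonzero in \<open>simp add: field_simps power_numeral_reduce\<close>)
    show ?thesis
      unfolding summand3_def 1 z12 2 using ne by (simp add: d_def)
  qed
  show ?thesis unfolding theta_sum_def s0 s1 s2 s3 by simp
qed

text \<open>
  A fixed point of \<open>z \<mapsto> 1 / z\<close> at which the factor \<open>z\<^sup>-\<^sup>5\<close> is \<open>-1\<close>.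
\<close>
lemma theta_sum_minus_one: "theta_sum q (-1) = 0"
  using theta_sum_inverse[of "-1"] by simp

text \<open>
  Here \<open>z = q (1 / z)\<close>, so inversion followed by the shift fixes \<open>z\<close>; the two factors multiply to \<open>-1\<close>.
\<close>
lemma theta_sum_zero_sqrt_q:
  assumes z: "z^2 = q"
  shows "theta_sum q z = 0"
proof -
  have z0: "z \<noteq> 0" and qz: "q * (1 / z) = z" using z q_nonzero by (auto simp: power2_eq_square)
  have "theta_sum q z = - 1 / (q^3 * (1 / z)^11) * (theta_sum q z / z^5)"
    using theta_sum_shift[of "1 / z"] theta_sum_inverse[OF z0] z0 unfolding qz by simp
  also have "- 1 / (q^3 * (1 / z)^11) * (theta_sum q z / z^5) = - theta_sum q z"
    unfolding z[symmetric] using z0 by (simp add: field_simps power_numeral_reduce)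
  finally show ?thesis by simp
qed

text \<open>
  Shifting by a power of \<open>q\<close> changes \<open>z\<^sup>4\<close> by a fourth power of \<open>q\<close>, and \<open>z\<^sup>2\<close> by a square. So only the
  parity of \<open>n\<close> matters in \<open>z\<^sup>4 = - q\<^sup>2\<^sup>n\<close> and in \<open>z\<^sup>2 = q\<^sup>n\<close>.
\<close>
lemma theta_sum_den_zero:
  assumes z: "z \<noteq> 0" and P: "theta_prod q z = 0"
  shows "theta_sum q z * theta_den q z = 0"
proof -
  have reduce: "theta_sum q z * theta_den q z = 0"
    if "theta_sum q (q powi m * z) * theta_den q (q powi m * z) = 0" for m
    using quasi_periodic_zero_shift[OF q_nonzero, of "\<lambda>z. theta_sum q z * theta_den q z" "\<lambda>z. 1 / (q^3 * z^12)" z m, OF theta_sum_den_shift]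
      q_nonzero z that by simp
  from P consider "qTheta (- (z ^ 4)) (q ^ 2) = 0" | "qTheta (z ^ 2) q = 0"
    by (auto simp: theta_prod_def)
  then show ?thesis
  proof cases
    case 1
    obtain n where n: "z^4 = - (q powi (2 * n))" using qTheta_quartic_zeros[OF z 1] .
    obtain m r where mr: "n = 2 * m + r" "r = 0 \<or> r = 1" by (rule int_div2_cases)
    define w where "w = q powi (- m) * z"
    have "w^4 = q powi (- m * int 4) * z^4"
      unfolding w_def power_int_mult power_int_of_nat by (rule power_mult_distrib)
    also have "\<dots> = - (q powi (- m * int 4 + 2 * n))"
      unfolding n mult_minus_right using q_nonzero by (subst power_int_add) auto
    also have "- m * int 4 + 2 * n = 2 * r" unfolding mr by simp
    finally have "w^4 = -1 \<or> w^4 = - (q^2)" using mr(2) by auto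
    then have "theta_sum q w * theta_den q w = 0"
      using theta_sum_zero_fourth_root_minus_one[of w] theta_sum_zero_fourth_power_minus_q2[of w] by auto
    then show ?thesis using reduce unfolding w_def by blast
  next
    case 2
    obtain n where n: "z^2 = q powi n" using qTheta_square_zeros[OF z 2] .
    obtain m r where mr: "n = 2 * m + r" "r = 0 \<or> r = 1" by (rule int_div2_cases)
    define w where "w = q powi (- m) * z"
    have "w^2 = q powi (- m * int 2) * z^2"
      unfolding w_def power_int_mult power_int_of_nat by (rule power_mult_distrib)
    also have "\<dots> = q powi (- m * int 2 + n)"
      unfolding n mult_minus_right using q_nonzero by (subst power_int_add) auto
    also have "- m * int 2 + n = r" unfolding mr by simp
    finally have "w = 1 \<or> w = -1 \<or> w^2 = q" using mr(2) by (auto simp: power2_eq_1_iff)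
    moreover have "theta_den q 1 = 0" using qTheta_one[OF q_power_nome(1), of 4] by (simp add: theta_den_def)
    ultimately have "theta_sum q w * theta_den q w = 0"
      using theta_sum_minus_one theta_sum_zero_sqrt_q[of w] by auto
    then show ?thesis using reduce unfolding w_def by blast
  qed
qed

lemma theta_sum_den_proportional:
  obtains C where "\<And>z. z \<noteq> 0 \<Longrightarrow> theta_sum q z * theta_den q z = C * theta_prod q z"
proof (rule quasi_periodic_proportional[OF q(2) q_nonzero theta_sum_den_holomorphic theta_prod_holomorphic
      theta_sum_den_shift theta_prod_shift])
  show "theta_sum q z * theta_den q z = 0 \<and> deriv (theta_prod q) z \<noteq> 0"
    if "z \<noteq> 0" "theta_prod q z = 0" for z
    using theta_sum_den_zero theta_prod_simple_zeros that by blast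
qed (use q_nonzero in auto)

section \<open>The value at the imaginary unit, and the identity\<close>

lemma qTheta_i:
  assumes "norm Q < 1"
  shows "qTheta \<i> Q = (1 - \<i>) * qpoch_inf (- (Q^2)) (Q^2) * qpoch_inf Q Q"
proof -
  have sq: "(Q * \<i>)^2 = - (Q^2)" by (simp add: power_mult_distrib)
  have div: "Q / \<i> = - (Q * \<i>)" by simp
  show ?thesis
    using qpoch_inf_rec[OF assms, of \<i>] qpoch_inf_mult_minus[OF assms, of "Q * \<i>"]
    unfolding qTheta_def sq div by simp
qed

lemma qTheta_i_nonzero: "qTheta \<i> q \<noteq> 0"
proof -
  have "qpoch_inf (q^2) (q^2) * qpoch_inf (- (q^2)) (q^2) = qpoch_inf (q^4) (q^4)"
    using qpoch_inf_mult_minus[OF q_power_nome(1), of 2 "q^2"] by (simp flip: power_mult)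
  then have "qpoch_inf (- (q^2)) (q^2) \<noteq> 0"
    using qpoch_inf_q_power_nonzero[of 4] by auto
  moreover have "1 - \<i> \<noteq> 0" by (simp add: complex_eq_iff)
  ultimately show ?thesis
    unfolding qTheta_i[OF q(2)] using qpoch_inf_self_nonzero[OF q(2)] by simp
qed

lemma theta_den_nonzero_iff: "theta_den q z \<noteq> 0 \<longleftrightarrow> qTheta z q \<noteq> 0"
  using theta_den_eq[of z] qpoch_inf_self_nonzero[OF q(2)] qpoch_inf_q_power_nonzero[of 4]
  by (metis mult_eq_0_iff power_eq_0_iff zero_less_numeral)

text \<open>
  The first summand contains \<open>\<Theta>(1; q\<^sup>1\<^sup>6) = 0\<close>. In the second and the fourth the denominator cancels, and
  in the third it can be evaluated because \<open>(1 - \<i> y) (1 + \<i> y) = 1 + y\<^sup>2\<close>.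
\<close>
lemma theta_sum_i:
  "theta_sum q \<i> = 2 * (1 + \<i>) * qpoch_inf (q^4) (q^8) * qpoch_inf (q^16) (q^16)"
proof -
  define e4 e8 e16 where "e4 = qpoch_inf (q^4) (q^4)"
    and "e8 = qpoch_inf (q^8) (q^8)" and "e16 = qpoch_inf (q^16) (q^16)"
  define m p u v where "m = qpoch_inf (- (q^8)) (q^8)" and "p = qpoch_inf (- (q^4)) (q^8)"
    and "u = qpoch_inf (q^4) (q^8)" and "v = qpoch_inf (q^8) (q^16)"
  have E: "e4 \<noteq> 0" "e8 \<noteq> 0" "e16 \<noteq> 0" using qpoch_inf_q_power_nonzero by (simp_all add: e4_def e8_def e16_def)
  have q0: "q \<noteq> 0" using q_nonzero .
  have i: "\<i>^3 = - \<i>" "\<i>^12 = 1" "\<i>^5 = \<i>" by (simp_all add: power_numeral_reduce)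
  have den: "qTheta (q * \<i>) (q^4) \<noteq> 0" "qTheta (q^2 * \<i>) (q^4) \<noteq> 0" "qTheta (q^3 * \<i>) (q^4) \<noteq> 0"
    using theta_den_nonzero_iff[of \<i>] qTheta_i_nonzero by (auto simp: theta_den_def)
  have div: "q^16 / q^4 = q^12" "q^16 / q^8 = q^8"
    using q0 by (simp_all add: field_simps flip: power_add)
  have T4: "qTheta (q^4) (q^16) = u * e16"
    using qpoch_inf_split[OF q_power_nome(1), of 8 "q^4"]
    by (simp add: qTheta_def div u_def e16_def flip: power_mult power_add)
  have T12: "qTheta (q^12) (q^16) = u * e16"
  proof -
    have "qTheta (q^12) (q^16) = qTheta (q^4) (q^16)"
      by (rule qTheta_reflectI) (simp add: div)
    then show ?thesis using T4 by simp
  qed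
  have T8: "qTheta (q^8) (q^16) = v * v * e16"
    by (simp add: qTheta_def div v_def e16_def)
  have up: "u * p = v"
    using qpoch_inf_mult_minus[OF q_power_nome(1), of 8 "q^4"] by (simp add: u_def p_def v_def flip: power_mult)
  have "e8 * m = e16"
    using qpoch_inf_mult_minus[OF q_power_nome(1), of 8 "q^8"] by (simp add: m_def e8_def e16_def flip: power_mult)
  moreover have "e8 = v * e16"
    using qpoch_inf_split[OF q_power_nome(1), of 8 "q^8"] by (simp add: v_def e8_def e16_def flip: power_mult power_add)
  ultimately have vm: "v * m = 1" using E by (simp add: field_simps)
  have p0: "p \<noteq> 0" using up vm by auto
  have Ti: "qTheta \<i> (q^4) = (1 - \<i>) * m * e4"
    using qTheta_i[OF q_power_nome(1), of 4] by (simp add: m_def e4_def flip: power_mult)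
  have Tq2i: "qTheta (q^2 * \<i>) (q^4) = p * e4"
  proof -
    have "(q^2 * \<i>)^2 = - (q^4)" by (simp add: power_mult_distrib flip: power_mult)
    moreover have "q^4 / (q^2 * \<i>) = - (q^2 * \<i>)" using q0 by (simp add: field_simps flip: power_add)
    ultimately show ?thesis
      using qpoch_inf_mult_minus[OF q_power_nome(1), of 4 "q^2 * \<i>"]
      by (simp add: qTheta_def p_def e4_def flip: power_mult)
  qed
  have s0: "summand0 q \<i> = 0"
    unfolding summand0_def i using qTheta_one[OF q_power_nome(1), of 16] by simp
  have s1: "summand1 q \<i> = \<i> * (u * e16)"
    unfolding summand1_def i using den T12 by simp
  have s2: "summand2 q \<i> = (1 + \<i>) * (u * e16)"
  proof -
    have "summand2 q \<i> = \<i> * ((1 - \<i>) * m * e4 * (v * v * e16) / (p * e4))"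
      unfolding summand2_def i using Ti T8 Tq2i by simp
    also have "\<dots> = \<i> * (1 - \<i>) * ((v * m) * v * e16 / p)"
      using E by simp
    also have "\<i> * (1 - \<i>) = 1 + \<i>" by (simp add: algebra_simps)
    also have "v = u * p" using up by simp
    also have "(1 + \<i>) * ((u * p * m) * (u * p) * e16 / p) = (1 + \<i>) * (u * p * m) * (u * e16)"
      using p0 by simp
    also have "u * p * m = 1" using vm up by simp
    finally show ?thesis by simp
  qed
  have s3: "summand3 q \<i> = u * e16"
    unfolding summand3_def i using den T4 by simp
  show ?thesis
    unfolding theta_sum_def s0 s1 s2 s3 by (simp add: u_def e16_def algebra_simps)
qed

text \<open>
  The claimed identity at \<open>z = \<i>\<close>. Splitting and pairing the infinite products reduces both sides to
  \<open>2 (1 + \<i>) (q\<^sup>1\<^sup>6; q\<^sup>1\<^sup>6) (q\<^sup>4; q\<^sup>4) (q\<^sup>2; q\<^sup>2)\<^sup>3\<close>.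
\<close>
lemma theta_sum_i_product:
  "theta_sum q \<i> * (qpoch_inf (q^8) (q^8) * qpoch_inf (q^2) (q^2) ^ 3)
     = qpoch_inf q q * qpoch_inf (q^16) (q^16) * qTheta (- (\<i>^4)) (q^2) * qTheta (q * \<i>^2) (q^2) * qTheta (- \<i>) q"
proof -
  define e1 e2 e4 e8 e16 where "e1 = qpoch_inf q q" and "e2 = qpoch_inf (q^2) (q^2)"
    and "e4 = qpoch_inf (q^4) (q^4)" and "e8 = qpoch_inf (q^8) (q^8)" and "e16 = qpoch_inf (q^16) (q^16)"
  define u m n s t where "u = qpoch_inf (q^4) (q^8)" and "m = qpoch_inf (- (q^2)) (q^2)"
    and "n = qpoch_inf (- q) (q^2)" and "s = qpoch_inf q (q^2)" and "t = qpoch_inf (q^2) (q^4)"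
  have q0: "q \<noteq> 0" using q_nonzero .
  have e2: "e2 \<noteq> 0" using qpoch_inf_q_power_nonzero[of 2] by (simp add: e2_def)
  have 1: "qTheta (-1) (q^2) * e2 = 2 * e4\<^sup>2"
    using qTheta_minus_one[OF q_power_nome(1), of 2] by (simp add: e2_def e4_def flip: power_mult)
  have 2: "qTheta (- q) (q^2) = n\<^sup>2 * e2"
    using q0 by (simp add: qTheta_def n_def e2_def power2_eq_square)
  have 3: "qTheta (- \<i>) q = (1 + \<i>) * m * e1"
  proof -
    have "qTheta (- \<i>) q = - qTheta \<i> q / \<i>"
      using qTheta_inverse[OF q(2) q0, of \<i>] by simp
    also have "\<dots> = \<i> * ((1 - \<i>) * m * e1)"
      unfolding qTheta_i[OF q(2)] m_def e1_def by simp
    finally show ?thesis by (simp add: algebra_simps)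
  qed
  have 4: "m * e2 = e4"
    using qpoch_inf_mult_minus[OF q_power_nome(1), of 2 "q^2"]
    by (simp add: m_def e2_def e4_def mult.commute flip: power_mult)
  have 5: "s * e2 = e1"
    using qpoch_inf_split[OF q(2), of q] by (simp add: s_def e1_def e2_def power2_eq_square)
  have 6: "s * n = t"
    using qpoch_inf_mult_minus[OF q_power_nome(1), of 2 q] by (simp add: s_def n_def t_def flip: power_mult)
  have 7: "t * e4 = e2"
    using qpoch_inf_split[OF q_power_nome(1), of 2 "q^2"] by (simp add: t_def e2_def e4_def flip: power_mult power_add)
  have 8: "u * e8 = e4"
    using qpoch_inf_split[OF q_power_nome(1), of 4 "q^4"] by (simp add: u_def e8_def e4_def flip: power_mult power_add)
  have "e1 * n = t * e2" unfolding 5[symmetric] 6[symmetric] by simp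
  then have "e1\<^sup>2 * n\<^sup>2 * e4\<^sup>2 = (t * e4)\<^sup>2 * e2\<^sup>2"
    unfolding power_mult_distrib[symmetric] by (simp add: mult_ac)
  then have sq: "e1\<^sup>2 * n\<^sup>2 * e4\<^sup>2 = e2 ^ 4"
    unfolding 7 by (simp flip: power_add)
  have "2 * (1 + \<i>) * u * e16 * (e8 * e2 ^ 3)
     = (e1 * e16 * (n\<^sup>2 * e2) * ((1 + \<i>) * m * e1)) * (qTheta (-1) (q^2))"
  proof -
    have "(e1 * e16 * (n\<^sup>2 * e2) * ((1 + \<i>) * m * e1)) * (qTheta (-1) (q^2))
        = 2 * (1 + \<i>) * e16 * m * (e1\<^sup>2 * n\<^sup>2 * e4\<^sup>2)"
      using 1 by algebra
    also have "\<dots> = 2 * (1 + \<i>) * e16 * (m * e2) * e2 ^ 3"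
      unfolding sq by (simp add: power_numeral_reduce)
    also have "\<dots> = 2 * (1 + \<i>) * u * e16 * (e8 * e2 ^ 3)"
      unfolding 4 8[symmetric] by simp
    finally show ?thesis by (rule sym)
  qed
  moreover have "- (\<i>^4) = (-1 :: complex)" "q * \<i>^2 = - q" by simp_all
  ultimately show ?thesis
    unfolding theta_sum_i e1_def[symmetric] e2_def[symmetric] e8_def[symmetric] e16_def[symmetric] u_def[symmetric]
    by (simp only: 2 3 mult_ac)
qed

end

theorem theorem9p3:
  fixes q z :: complex
  assumes "0 < norm q" and "norm q < 1"
    and "z \<noteq> 0"
    and "qTheta z (q ^ 4) \<noteq> 0"
    and "qTheta (q * z) (q ^ 4) \<noteq> 0"
    and "qTheta (q ^ 2 * z) (q ^ 4) \<noteq> 0"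
    and "qTheta (q ^ 3 * z) (q ^ 4) \<noteq> 0"
  shows "- q * z powi (-3) *
           (qTheta (- (q ^ 2) * z ^ 3) (q ^ 4) * qTheta (z ^ 12) (q ^ 16) / qTheta z (q ^ 4))
       + z ^ 5 *
           (qTheta (- q * z ^ 3) (q ^ 4) * qTheta (q ^ 12 * z ^ 12) (q ^ 16) / qTheta (q * z) (q ^ 4))
       + z *
           (qTheta (- (z ^ 3)) (q ^ 4) * qTheta (q ^ 8 * z ^ 12) (q ^ 16) / qTheta (q ^ 2 * z) (q ^ 4))
       + qTheta (- (q ^ 3) * z ^ 3) (q ^ 4) * qTheta (q ^ 4 * z ^ 12) (q ^ 16) / qTheta (q ^ 3 * z) (q ^ 4)
     = qpoch_inf q q * qpoch_inf (q ^ 16) (q ^ 16)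
         * qTheta (- (z ^ 4)) (q ^ 2) * qTheta (q * z ^ 2) (q ^ 2) * qTheta (- z) q
       / (qpoch_inf (q ^ 8) (q ^ 8) * qpoch_inf (q ^ 2) (q ^ 2) ^ 3)"
proof -
  note q = assms(1,2)
  define e1 e2 e4 e8 e16 where "e1 = qpoch_inf q q" and "e2 = qpoch_inf (q^2) (q^2)"
    and "e4 = qpoch_inf (q^4) (q^4)" and "e8 = qpoch_inf (q^8) (q^8)" and "e16 = qpoch_inf (q^16) (q^16)"
  note e_defs = e1_def e2_def e4_def e8_def e16_def
  have E: "e1 \<noteq> 0" "e2 \<noteq> 0" "e4 \<noteq> 0" "e8 \<noteq> 0" "e16 \<noteq> 0"
    using qpoch_inf_q_power_nonzero[OF q] qpoch_inf_self_nonzero[OF q(2)] by (simp_all add: e_defs)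
  define R where "R = (\<lambda>z. qTheta (- (z^4)) (q^2) * qTheta (q * z^2) (q^2) * qTheta (- z) q)"
  obtain C where C: "\<And>z. z \<noteq> 0 \<Longrightarrow> theta_sum q z * theta_den q z = C * theta_prod q z"
    using theta_sum_den_proportional[OF q] by blast
  have proportional: "theta_sum q z * (e4^4 * e2) = C * R z" if "z \<noteq> 0" "qTheta z q \<noteq> 0" for z
  proof -
    have "theta_sum q z * (e4^4 * e2) * qTheta z q = theta_sum q z * (theta_den q z * e1) * e2"
      using theta_den_eq[OF q, of z] by (simp add: e_defs)
    also have "\<dots> = C * (theta_prod q z * (e1 * e2))"
      using C[OF that(1)] by algebra
    also have "\<dots> = C * R z * qTheta z q"
      using theta_prod_eq[OF q, of z] by (simp add: e_defs R_def)
    finally show ?thesis using that by simp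
  qed
  \<comment> \<open>At \<open>\<i>\<close> both sides are known and nonzero, which determines \<open>C\<close>.\<close>
  have at_i: "theta_sum q \<i> * (e8 * e2^3) = e1 * e16 * R \<i>"
    using theta_sum_i_product[OF q] by (simp add: e_defs R_def mult.assoc)
  have "qpoch_inf (q^4) (q^8) * e8 = e4"
    using qpoch_inf_split[OF q_power_nome(1)[OF q], of 4 "q^4"] by (simp add: e8_def e4_def flip: power_mult power_add)
  moreover have "2 + 2 * \<i> \<noteq> 0" by (simp add: complex_eq_iff)
  ultimately have "theta_sum q \<i> \<noteq> 0"
    unfolding theta_sum_i[OF q] e16_def[symmetric] using E by auto
  then have "R \<i> \<noteq> 0" using at_i E by auto
  moreover have "C * (e8 * e2^3) * R \<i> = (e4^4 * e2 * (e1 * e16)) * R \<i>"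
    using proportional[of \<i>] qTheta_i_nonzero[OF q] at_i by simp algebra
  ultimately have Cval: "C * (e8 * e2^3) = e4^4 * e2 * (e1 * e16)" by simp
  have "theta_den q z \<noteq> 0" using assms by (simp add: theta_den_def)
  then have "theta_sum q z * (e4^4 * e2) = C * R z"
    using proportional assms(3) theta_den_nonzero_iff[OF q] by blast
  then have "theta_sum q z * (e8 * e2^3) * (e4^4 * e2) = e1 * e16 * R z * (e4^4 * e2)"
    using Cval by algebra
  then have "theta_sum q z * (e8 * e2^3) = e1 * e16 * R z" using E by simp
  then have "theta_sum q z = e1 * e16 * R z / (e8 * e2^3)" using E by (simp add: field_simps)
  then show ?thesis
    unfolding theta_sum_def summand_defs e_defs R_def by (simp only: mult.assoc)
qed

end
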